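(* Let $G$ be a bipartite graph with $m$ left vertices. Then, for all nonnegative integers $k_1,\dots,k_m$, the polytope $Q_G(k_1,\dots,k_m)$ is Ehrhart positive, i.e., every coefficient of its Ehrhart polynomial (the coefficients of $t^0,t^1,\dots,t^d$, where $d=\dim Q_G(k_1,\dots,k_m)$) is strictly positive.
   Context: $G$ is a bipartite graph with left vertices $\ell_1,\dots,\ell_m$ and right vertices $r_1,\dots,r_n$; $I_j=\{i\in[n]\mid\ell_j\text{ is adjacent to }r_i\}$ for $j\in[m]$. For nonempty $I\subset[n]$, $\diamondsuit_I=\operatorname{conv}(\pm\boldsymbol e_i\mid i\in I)\subset\mathbb R^n$ is the cross polytope, and $\diamondsuit_\varnothing=\{\boldsymbol 0\}$. $Q_G(k_1,\dots,k_m)=k_1\diamondsuit_{I_1}+\cdots+k_m\diamondsuit_{I_m}$ (Minkowski sum). The Ehrhart polynomial of a lattice polytope $P\subset\mathbb R^n$ is the polynomial $i(P,t)$, of degree $\dim P$, with $i(P,t)=|tP\cap\mathbb Z^n|$ for all $t\in\mathbb Z_{\ge0}$. *)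

theory Defs
  imports "HOL-Analysis.Analysis" "HOL-Computational_Algebra.Polynomial"
begin

section \<open>Ehrhart polynomials\<close>

definition integer_points :: "(real ^ 'n) set" where
  "integer_points = {x. \<forall>i. x $ i \<in> \<int>}"

text \<open>Only meaningful for bounded \<open>P\<close>, since \<^const>\<open>card\<close> is \<open>0\<close> on infinite sets.\<close>

definition lattice_count :: "(real ^ 'n) set \<Rightarrow> nat \<Rightarrow> nat" where
  "lattice_count P t = card (((*\<^sub>R) (real t) ` P) \<inter> integer_points)"

definition is_ehrhart_polynomial :: "(real ^ 'n) set \<Rightarrow> real poly \<Rightarrow> bool" where
  "is_ehrhart_polynomial P p \<longleftrightarrow>
     int (degree p) = aff_dim P \<and> (\<forall>t::nat. poly p (real t) = real (lattice_count P t))"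

lemma is_ehrhart_polynomial_unique:
  assumes "is_ehrhart_polynomial P p" "is_ehrhart_polynomial P q"
  shows "p = q"
proof (rule ccontr)
  assume "p \<noteq> q"
  then have "finite {x. poly (p - q) x = 0}"
    by (intro poly_roots_finite) simp
  moreover have "range real \<subseteq> {x. poly (p - q) x = 0}"
    using assms by (auto simp: is_ehrhart_polynomial_def)
  ultimately have "finite (range real)"
    by (rule rev_finite_subset)
  then show False
    using finite_imageD[of real UNIV] by (simp add: inj_of_nat)
qed

text \<open>The existence of the Ehrhart polynomial is part of this predicate; by
  \<open>is_ehrhart_polynomial_unique\<close> the witness is unique.\<close>

definition ehrhart_positive :: "(real ^ 'n) set \<Rightarrow> bool" where
  "ehrhart_positive P \<longleftrightarrow>
     (\<exists>p. is_ehrhart_polynomial P p \<and> (\<forall>i::nat. int i \<le> aff_dim P \<longrightarrow> 0 < coeff p i))"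

section \<open>Cross polytopes and bipartite graphs\<close>

definition cross_polytope :: "'n set \<Rightarrow> (real ^ 'n) set" where
  "cross_polytope I =
     (if I = {} then {0}
      else convex hull ((\<lambda>i. axis i 1) ` I \<union> (\<lambda>i. - axis i 1) ` I))"

text \<open>A bipartite graph with a fixed bipartition into left vertices \<open>L\<close> and right vertices \<open>R\<close>;
  an edge is recorded as the pair of its left and its right end.\<close>

definition bipartite_graph :: "'l set \<Rightarrow> 'r set \<Rightarrow> ('l \<times> 'r) set \<Rightarrow> bool" where
  "bipartite_graph L R E \<longleftrightarrow> E \<subseteq> L \<times> R"

definition nbrs :: "('l \<times> 'r) set \<Rightarrow> 'l \<Rightarrow> 'r set" where
  "nbrs E j = {i. (j, i) \<in> E}"

text \<open>The left vertices are \<open>1, \<dots>, m\<close>; the right vertices are the coordinates \<open>'n\<close>. The sum is the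
  Minkowski sum of sets from \<^theory>\<open>HOL-Library.Set_Algebras\<close>; the empty sum is \<open>{0}\<close>.\<close>

definition Q_polytope :: "nat \<Rightarrow> (nat \<times> 'n) set \<Rightarrow> (nat \<Rightarrow> nat) \<Rightarrow> (real ^ 'n) set" where
  "Q_polytope m E k = (\<Sum>j\<in>{1..m}. (*\<^sub>R) (real (k j)) ` cross_polytope (nbrs E j))"

end

theory Submission
  imports Defs
begin

text \<open>
  A point \<open>x\<close> lies in \<open>Q\<^sub>G(k)\<close> iff \<open>\<bar>x\<bar>\<close> lies in a polymatroid, and by Hall's theorem the integer
  points of the latter are the degree vectors \<open>x\<close> on the right of the subgraphs in which each of the
  \<open>k\<^sub>j\<close> copies of the left vertex \<open>j\<close> has degree at most one. Hence
  \<open>\<bar>Q\<^sub>G(k) \<inter> \<int>\<^sup>n\<bar> = \<Sum>\<^sub>x 2\<^bsup>|supp x|\<^esup>\<close>. The key is that for a fixed set \<open>T\<close> of right vertices there are as many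
  such \<open>x\<close> with support \<open>T\<close> as sets \<open>J\<close> of left vertices perfectly matched to \<open>T\<close>. As the pairs
  \<open>(J, T)\<close> are symmetric in the two sides, the sum is unchanged when the sides are exchanged, and
  summing over the copies turns it into \<open>\<Sum>\<^sub>a \<Prod>\<^sub>j g\<^bsub>a\<^sub>j\<^esub>(k\<^sub>j)\<close>, where \<open>a\<close> ranges over the degree vectors on
  the left and \<open>g\<^sub>a(x)\<close> is the coefficient of \<open>z\<^sup>a\<close> in \<open>((1 + z) / (1 - z))\<^sup>x\<close>, a polynomial of degree
  \<open>a\<close> in \<open>x\<close> with nonnegative coefficients.

  The equality of the two numbers is an optimal transport argument. Add a root adjacent to all left
  vertices and choose generic integer weights on the complete bipartite graph, non-edges being more
  expensive than all edges together. For every \<open>J\<close> with \<open>|J| = |T|\<close> there is a dual potential for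
  which \<open>J\<close> is the set of left vertices with two tight edges, these edges forming a spanning tree
  on \<open>T\<close> and the root; orienting the tree towards the root gives a cheapest assignment, whose
  degree vector is \<open>x\<close>. The assignment is determined by \<open>x\<close>, the potential is the least one for which it
  is tight, so \<open>J \<mapsto> x\<close> is injective; both sides have the same size in the complete graph, and the
  weights of the non-edges make the bijection respect the given graph.
\<close>

section \<open>Spanning trees of tight edges\<close>

lemma sum_of_bool_eq_mult:
  fixes f :: "'a \<Rightarrow> 'b::semiring_1"
  assumes "finite A" "a \<in> A"
  shows "(\<Sum>e\<in>A. of_bool (e = a) * f e) = f a"
proof -
  have "(\<Sum>e\<in>A. of_bool (e = a) * f e) = (\<Sum>e\<in>A. if e = a then f e else 0)"
    by (intro sum.cong) auto
  then show ?thesis using assms by simp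
qed

text \<open>\<open>None\<close> is the added root. The bound 3 is what \<open>subtree_tight\<close>
  consumes: two potentials with coefficients at most 1 each, and one further edge. Integral weights
  let a bounded dual objective attain its maximum.\<close>

locale generic_weights =
  fixes L :: "'a set" and T :: "'b set" and w :: "'a \<times> 'b option \<Rightarrow> int"
  assumes finite_L: "finite L" and finite_T: "finite T"
    and w_nonneg: "0 \<le> w e"
    and generic: "\<lbrakk>\<And>e. \<bar>c e\<bar> \<le> 3; (\<Sum>e\<in>L \<times> insert None (Some ` T). c e * w e) = 0;
        e \<in> L \<times> insert None (Some ` T)\<rbrakk> \<Longrightarrow> c e = 0"
begin

definition R :: "'b option set" where "R = insert None (Some ` T)"

text \<open>Complementary slackness of a transportation problem: \<open>b\<close> prices the right
  vertices and the root, and \<open>j\<close> may only use targets of least reduced cost.\<close>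

definition tight :: "('b option \<Rightarrow> int) \<Rightarrow> 'a \<Rightarrow> 'b option \<Rightarrow> bool" where
  "tight b j s \<longleftrightarrow> s \<in> R \<and> (\<forall>t\<in>R. w (j, s) - b s \<le> w (j, t) - b t)"

lemma finite_R: "finite R" and None_in_R: "None \<in> R" and card_R: "card R = card T + 1"
  using finite_T by (auto simp: R_def card_image)

lemma tight_in_R: "tight b j s \<Longrightarrow> s \<in> R"
  by (simp add: tight_def)

lemma tight_eq: "tight b j s \<Longrightarrow> tight b j t \<Longrightarrow> w (j, s) - b s = w (j, t) - b t"
  by (auto simp: tight_def intro: antisym)

text \<open>The best dual variable at a left vertex for the given prices.\<close>

definition lev :: "('b option \<Rightarrow> int) \<Rightarrow> 'a \<Rightarrow> int" where
  "lev b j = Min ((\<lambda>t. w (j, t) - b t) ` R)"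

lemma lev_le: "t \<in> R \<Longrightarrow> lev b j \<le> w (j, t) - b t"
  unfolding lev_def using finite_R by (intro Min_le) auto

lemma tight_iff_lev: "tight b j s \<longleftrightarrow> s \<in> R \<and> w (j, s) - b s = lev b j"
proof -
  have "lev b j \<in> (\<lambda>t. w (j, t) - b t) ` R"
    unfolding lev_def using finite_R None_in_R by (intro Min_in) auto
  then show ?thesis
    by (auto simp: tight_def dest: lev_le[of _ b j] intro: antisym)
qed

lemma exists_tight: "\<exists>s. tight b j s"
proof -
  have "lev b j \<in> (\<lambda>t. w (j, t) - b t) ` R"
    unfolding lev_def using finite_R None_in_R by (intro Min_in) auto
  then show ?thesis
    by (auto simp: tight_iff_lev)
qed

text \<open>The conclusion is the dragon marriage condition, Hall's condition with surplus one. It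
  comes from an optimal dual solution of the transportation problem in which each vertex of
  \<open>J\<close> supplies \<open>n + 1\<close> units and each of the \<open>n + 1\<close> elements
  of \<open>R\<close> demands \<open>n\<close>: a set violating it would allow a better choice of
  prices.\<close>

lemma exists_dragon_potential:
  assumes J: "J \<subseteq> L" "card J = card T"
  obtains b where "b None = 0"
    "\<And>J'. J' \<subseteq> J \<Longrightarrow> J' \<noteq> {} \<Longrightarrow> card J' < card {s. \<exists>j\<in>J'. tight b j s}"
proof -
  define n where "n = card T"
  define \<Phi> where "\<Phi> b = (int n + 1) * (\<Sum>j\<in>J. lev b j) + int n * (\<Sum>t\<in>R. b t)" for b
  define C where "C = (\<Sum>j\<in>J. \<Sum>t\<in>R. w (j, t))"
  have finJ: "finite J" using J finite_L finite_subset by blast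
  \<comment> \<open>Bounding \<open>lev b j\<close> by all \<open>n + 1\<close> reduced costs at
    \<open>j\<close> at once makes the potentials cancel against the second sum of
    \<open>\<Phi>\<close>.\<close>
  have le_C: "\<Phi> b \<le> C" for b
  proof -
    have "(int n + 1) * (\<Sum>j\<in>J. lev b j) = (\<Sum>j\<in>J. \<Sum>t\<in>R. lev b j)"
      by (simp add: card_R n_def sum_distrib_left algebra_simps)
    also have "\<dots> \<le> (\<Sum>j\<in>J. \<Sum>t\<in>R. w (j, t) - b t)"
      by (intro sum_mono lev_le)
    also have "\<dots> = C - int n * (\<Sum>t\<in>R. b t)"
      by (simp add: C_def sum_subtractf J n_def)
    finally show ?thesis by (simp add: \<Phi>_def)
  qed
  \<comment> \<open>The gap between \<open>\<Phi>\<close> and its bound \<open>C\<close> is a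
    natural number, so it has a least value.\<close>
  obtain b0 where b0: "nat (C - \<Phi> b0) \<le> nat (C - \<Phi> b)" for b
    using ex_has_least_nat[of "\<lambda>_. True" _ "\<lambda>b. nat (C - \<Phi> b)"] by auto
  have max: "\<Phi> b \<le> \<Phi> b0" for b
    using b0[of b] le_C[of b] le_C[of b0] by linarith
  have dragon: "card J' < card {s. \<exists>j\<in>J'. tight b0 j s}" if J': "J' \<subseteq> J" "J' \<noteq> {}" for J'
  proof (rule ccontr)
    define S where "S = {s. \<exists>j\<in>J'. tight b0 j s}"
    assume "\<not> card J' < card {s. \<exists>j\<in>J'. tight b0 j s}"
    then have cS: "card S \<le> card J'" by (simp add: S_def)
    have SR: "S \<subseteq> R" by (auto simp: S_def tight_in_R)
    have finJ': "finite J'" using J' finJ finite_subset by blast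
    \<comment> \<open>Prices drop by 1 on \<open>S\<close> only. By integrality each level on
      \<open>J'\<close> rises by at least 1 and no level on \<open>J\<close> falls, so
      \<open>\<Phi>\<close> gains at least \<open>(n + 1) * card J' - n * card S\<close>, which is
      positive here.\<close>
    define b where "b t = b0 t - of_bool (t \<in> S)" for t
    have lev_b: "lev b0 j + of_bool (j \<in> J') \<le> lev b j" if "j \<in> J" for j
    proof -
      have "lev b0 j + of_bool (j \<in> J') \<le> w (j, t) - b t" if "t \<in> R" for t
      proof (cases "t \<in> S")
        case True
        then show ?thesis using lev_le[OF that, of b0 j] by (simp add: b_def)
      next
        case False
        then have "w (j, t) - b0 t \<noteq> lev b0 j" if "j \<in> J'"
          using that \<open>t \<in> R\<close> by (auto simp: S_def tight_iff_lev)
        then show ?thesis using False lev_le[OF that, of b0 j] by (auto simp: b_def)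
      qed
      then show ?thesis
        unfolding lev_def[of b] using finite_R None_in_R by (subst Min_ge_iff) auto
    qed
    have "(\<Sum>j\<in>J. lev b0 j) + int (card J') = (\<Sum>j\<in>J. lev b0 j + of_bool (j \<in> J'))"
      using J' finJ by (simp add: sum.distrib of_bool_def sum.If_cases Int_absorb1)
    also have "\<dots> \<le> (\<Sum>j\<in>J. lev b j)"
      by (intro sum_mono lev_b)
    finally have 1: "(\<Sum>j\<in>J. lev b0 j) + int (card J') \<le> (\<Sum>j\<in>J. lev b j)" .
    have 2: "(\<Sum>t\<in>R. b t) = (\<Sum>t\<in>R. b0 t) - int (card S)"
      using SR finite_R by (simp add: b_def sum_subtractf of_bool_def sum.If_cases Int_absorb1)
    have "(int n + 1) * ((\<Sum>j\<in>J. lev b0 j) + int (card J')) \<le> (int n + 1) * (\<Sum>j\<in>J. lev b j)"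
      using 1 by (intro mult_left_mono) auto
    then have "\<Phi> b0 + (int n + 1) * int (card J') - int n * int (card S) \<le> \<Phi> b"
      by (simp add: \<Phi>_def 2 algebra_simps)
    moreover have "int n * int (card S) \<le> int n * int (card J')"
      using cS by (intro mult_left_mono) auto
    moreover have "0 < card J'" using J' finJ' by (simp add: card_gt_0_iff)
    ultimately show False using max[of b] by (simp add: algebra_simps)
  qed
  \<comment> \<open>Tightness is invariant under adding a constant to the potential, so the root may
    be normalised to 0.\<close>
  have shift: "tight (\<lambda>t. b0 t - b0 None) = tight b0"
    by (auto simp: tight_def fun_eq_iff)
  show thesis
    by (rule that[of "\<lambda>t. b0 t - b0 None"]) (use dragon shift in auto)
qed

text \<open>A subtree of the tight graph that contains the root \<open>None\<close>: the edge \<open>j \<in> K\<close> joins the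
  vertex \<open>\<sigma> j\<close> to its parent \<open>p j\<close>. The function \<open>c v\<close> writes the potential at \<open>v\<close> as an
  integer combination of weights, so that genericity excludes a further tight pair.\<close>

definition subtree where
  "subtree b V K \<sigma> p c \<longleftrightarrow>
     V \<subseteq> R \<and> None \<in> V \<and> K \<subseteq> L \<and> card V = card K + 1 \<and> bij_betw \<sigma> K (V - {None}) \<and>
     (\<forall>j\<in>K. tight b j (\<sigma> j) \<and> tight b j (p j) \<and> p j \<noteq> \<sigma> j \<and> p j \<in> V) \<and>
     (\<forall>v\<in>V. (v, None) \<in> {(\<sigma> j, p j) | j. j \<in> K}\<^sup>*) \<and>
     (\<forall>v\<in>V. b v \<le> (\<Sum>j\<in>K. w (j, \<sigma> j))) \<and>
     (\<forall>v\<in>V. b v = (\<Sum>e\<in>L \<times> R. c v e * w e)) \<and>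
     (\<forall>v e. \<bar>c v e\<bar> \<le> (1::int)) \<and>
     (\<forall>v\<in>V. \<forall>j s. c v (j, s) \<noteq> 0 \<longrightarrow> j \<in> K \<and> (s = \<sigma> j \<or> s = p j))"

lemma subtreeD:
  assumes "subtree b V K \<sigma> p c"
  shows "V \<subseteq> R" "None \<in> V" "K \<subseteq> L" "card V = card K + 1" "bij_betw \<sigma> K (V - {None})"
    "\<And>j. j \<in> K \<Longrightarrow> tight b j (\<sigma> j)" "\<And>j. j \<in> K \<Longrightarrow> tight b j (p j)"
    "\<And>j. j \<in> K \<Longrightarrow> p j \<noteq> \<sigma> j" "\<And>j. j \<in> K \<Longrightarrow> p j \<in> V"
    "\<And>v. v \<in> V \<Longrightarrow> (v, None) \<in> {(\<sigma> j, p j) | j. j \<in> K}\<^sup>*"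
    "\<And>v. v \<in> V \<Longrightarrow> b v \<le> (\<Sum>j\<in>K. w (j, \<sigma> j))"
    "\<And>v. v \<in> V \<Longrightarrow> b v = (\<Sum>e\<in>L \<times> R. c v e * w e)"
    "\<And>v e. \<bar>c v e\<bar> \<le> 1"
    "\<And>v j s. v \<in> V \<Longrightarrow> c v (j, s) \<noteq> 0 \<Longrightarrow> j \<in> K \<and> (s = \<sigma> j \<or> s = p j)"
  using assms unfolding subtree_def by blast+

text \<open>If \<open>j\<close> is tight at \<open>u\<close> and \<open>v\<close>, then
  \<open>b u - b v\<close> equals \<open>w (j, u) - w (j, v)\<close>. Writing both potentials
  through \<open>c\<close> gives a vanishing combination of weights, so by genericity its
  coefficient at \<open>(j, u)\<close> is 0. The edge \<open>(j, u)\<close> must then already occur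
  in \<open>c u\<close> or \<open>c v\<close>, that is, in the tree.\<close>

lemma subtree_tight:
  assumes st: "subtree b V K \<sigma> p c" and j: "j \<in> L" and uv: "u \<in> V" "v \<in> V" "u \<noteq> v"
    and t: "tight b j u" "tight b j v"
  shows "j \<in> K \<and> (u = \<sigma> j \<or> u = p j)"
proof (rule ccontr)
  assume neg: "\<not> (j \<in> K \<and> (u = \<sigma> j \<or> u = p j))"
  have fin: "finite (L \<times> R)" using finite_L finite_R by simp
  have VR: "V \<subseteq> R" using st by (simp add: subtree_def)
  then have in': "(j, u) \<in> L \<times> R" "(j, v) \<in> L \<times> R" using j uv by auto
  define d where "d e = c u e - c v e - of_bool (e = (j, u)) + of_bool (e = (j, v))" for e
  have d3: "\<bar>d e\<bar> \<le> 3" for e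
  proof -
    have "\<bar>c u e\<bar> \<le> 1" "\<bar>c v e\<bar> \<le> 1" using subtreeD(13)[OF st] by blast+
    then show ?thesis using uv by (auto simp: d_def of_bool_def)
  qed
  have "(\<Sum>e\<in>L \<times> R. d e * w e) = (\<Sum>e\<in>L \<times> R. c u e * w e) - (\<Sum>e\<in>L \<times> R. c v e * w e)
     - w (j, u) + w (j, v)"
    unfolding d_def distrib_right left_diff_distrib sum.distrib sum_subtractf
    by (simp only: sum_of_bool_eq_mult[OF fin] in')
  also have "\<dots> = 0"
    using subtreeD(12)[OF st uv(1)] subtreeD(12)[OF st uv(2)] tight_eq[OF t] by simp
  finally have "d (j, u) = 0"
    using generic[of d "(j, u)"] d3 in' by (simp add: R_def)
  moreover have "c u (j, u) = 0" "c v (j, u) = 0"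
    using neg subtreeD(14)[OF st] uv by blast+
  ultimately show False using uv by (simp add: d_def)
qed

lemma subtree_root:
  assumes "b None = 0"
  shows "subtree b {None} {} \<sigma> p (\<lambda>_ _. 0)"
  using assms None_in_R by (auto simp: subtree_def bij_betw_def)

text \<open>The new leaf \<open>v\<close> has potential \<open>b u + w (j, v) - w (j, u)\<close>.
  The bound by the weights of the edges to children persists because weights are
  nonnegative.\<close>

lemma subtree_extend:
  assumes st: "subtree b V K \<sigma> p c"
    and j: "j \<in> L" "j \<notin> K" and u: "u \<in> V" "tight b j u" and v: "v \<notin> V" "tight b j v"
  shows "\<exists>c'. subtree b (insert v V) (insert j K) (\<sigma>(j := v)) (p(j := u)) c'"
proof -
  define c' where "c' = c(v := (\<lambda>e. c u e + of_bool (e = (j, v)) - of_bool (e = (j, u))))"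
  let ?\<sigma> = "\<sigma>(j := v)" and ?p = "p(j := u)"
  have fin: "finite (L \<times> R)" using finite_L finite_R by simp
  have VR: "V \<subseteq> R" and KL: "K \<subseteq> L" and NV: "None \<in> V" using st by (simp_all add: subtree_def)
  then have finV: "finite V" and finK: "finite K"
    using finite_R finite_L finite_subset by blast+
  have uv: "u \<noteq> v" using u v by blast
  have in': "(j, u) \<in> L \<times> R" "(j, v) \<in> L \<times> R" using j u v tight_in_R by auto
  have sumK: "(\<Sum>i\<in>insert j K. w (i, ?\<sigma> i)) = (\<Sum>i\<in>K. w (i, \<sigma> i)) + w (j, v)"
  proof -
    have "(\<Sum>i\<in>K. w (i, ?\<sigma> i)) = (\<Sum>i\<in>K. w (i, \<sigma> i))"
      using j by (intro sum.cong) auto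
    then show ?thesis using j finK by simp
  qed
  have bv: "b v = b u + w (j, v) - w (j, u)" using tight_eq[OF u(2) v(2)] by simp
  have bij: "bij_betw ?\<sigma> (insert j K) (insert v V - {None})"
  proof -
    have "bij_betw ?\<sigma> K (V - {None})"
      using st j by (subst bij_betw_cong[of K _ \<sigma>]) (auto simp: subtree_def)
    moreover have "insert v V - {None} = (V - {None}) \<union> {?\<sigma> j}" using v NV by auto
    ultimately show ?thesis
      using notIn_Un_bij_betw[of j K ?\<sigma> "V - {None}"] j v by simp
  qed
  have reach: "(x, None) \<in> {(?\<sigma> i, ?p i) | i. i \<in> insert j K}\<^sup>*" if "x \<in> insert v V" for x
  proof -
    have sub: "{(\<sigma> i, p i) | i. i \<in> K} \<subseteq> {(?\<sigma> i, ?p i) | i. i \<in> insert j K}"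
      using j by force
    have old: "(y, None) \<in> {(?\<sigma> i, ?p i) | i. i \<in> insert j K}\<^sup>*" if "y \<in> V" for y
      using subtreeD(10)[OF st that] rtrancl_mono[OF sub] by blast
    have "(v, u) \<in> {(?\<sigma> i, ?p i) | i. i \<in> insert j K}" by force
    with old[OF u(1)] have "(v, None) \<in> {(?\<sigma> i, ?p i) | i. i \<in> insert j K}\<^sup>*"
      by (rule converse_rtrancl_into_rtrancl[rotated])
    with old that show ?thesis by blast
  qed
  have "subtree b (insert v V) (insert j K) ?\<sigma> ?p c'"
    unfolding subtree_def
  proof (intro conjI)
    show "insert v V \<subseteq> R" using VR v tight_in_R by auto
    show "card (insert v V) = card (insert j K) + 1"
      using st j v finV finK by (simp add: subtree_def)
    show "bij_betw ?\<sigma> (insert j K) (insert v V - {None})" by (rule bij)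
    show "\<forall>i\<in>insert j K. tight b i (?\<sigma> i) \<and> tight b i (?p i) \<and> ?p i \<noteq> ?\<sigma> i \<and> ?p i \<in> insert v V"
      using st j u v uv by (auto simp: subtree_def)
    show "\<forall>x\<in>insert v V. (x, None) \<in> {(?\<sigma> i, ?p i) | i. i \<in> insert j K}\<^sup>*"
      using reach by blast
    have wj: "0 \<le> w (j, v)" "0 \<le> w (j, u)" using w_nonneg by auto
    have old: "b y \<le> (\<Sum>i\<in>K. w (i, \<sigma> i))" if "y \<in> V" for y
      using subtreeD(11)[OF st that] .
    show "\<forall>x\<in>insert v V. b x \<le> (\<Sum>i\<in>insert j K. w (i, ?\<sigma> i))"
    proof
      fix x assume "x \<in> insert v V"
      then consider "x = v" | "x \<in> V" by blast
      then show "b x \<le> (\<Sum>i\<in>insert j K. w (i, ?\<sigma> i))"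
        unfolding sumK proof cases
        case 1
        then show "b x \<le> (\<Sum>i\<in>K. w (i, \<sigma> i)) + w (j, v)"
          using wj old[OF u(1)] bv by simp
      next
        case 2
        then show "b x \<le> (\<Sum>i\<in>K. w (i, \<sigma> i)) + w (j, v)"
          using wj old[OF 2] by simp
      qed
    qed
    have eqs: "b y = (\<Sum>e\<in>L \<times> R. c y e * w e)" if "y \<in> V" for y
      using subtreeD(12)[OF st that] .
    have "(\<Sum>e\<in>L \<times> R. c' v e * w e) = (\<Sum>e\<in>L \<times> R. c u e * w e) + w (j, v) - w (j, u)"
      unfolding c'_def fun_upd_same distrib_right left_diff_distrib sum.distrib sum_subtractf
      by (simp only: sum_of_bool_eq_mult[OF fin] in')
    then have "b v = (\<Sum>e\<in>L \<times> R. c' v e * w e)" using bv eqs[OF u(1)] by simp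
    moreover have "c' y = c y" if "y \<in> V" for y using that v by (auto simp: c'_def)
    ultimately show "\<forall>x\<in>insert v V. b x = (\<Sum>e\<in>L \<times> R. c' x e * w e)"
      using eqs by simp
    \<comment> \<open>Since \<open>j\<close> is new, the two added terms of \<open>c' v\<close> fall
      on edges where \<open>c u\<close> vanishes; the coefficients stay within absolute value
      1.\<close>
    have cu0: "c u (j, s) = 0" for s using subtreeD(14)[OF st u(1)] j by blast
    have c1: "\<bar>c y e\<bar> \<le> 1" for y e using subtreeD(13)[OF st] .
    show "\<forall>x e. \<bar>c' x e\<bar> \<le> 1"
    proof (intro allI)
      fix x e
      show "\<bar>c' x e\<bar> \<le> 1"
        using c1[of x e] c1[of u e] cu0[of "snd e"] uv by (cases e) (auto simp: c'_def of_bool_def)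
    qed
    have supp: "i \<in> K \<and> (s = \<sigma> i \<or> s = p i)" if "y \<in> V" "c y (i, s) \<noteq> 0" for y i s
      using subtreeD(14)[OF st that] .
    show "\<forall>x\<in>insert v V. \<forall>i s. c' x (i, s) \<noteq> 0 \<longrightarrow> i \<in> insert j K \<and> (s = ?\<sigma> i \<or> s = ?p i)"
    proof (intro ballI allI impI)
      fix x i s assume x: "x \<in> insert v V" and nz: "c' x (i, s) \<noteq> 0"
      show "i \<in> insert j K \<and> (s = ?\<sigma> i \<or> s = ?p i)"
      proof (cases "x = v")
        case True
        then show ?thesis using nz supp[OF u(1), of i s] cu0[of s] j
          by (auto simp: c'_def of_bool_def split: if_splits)
      next
        case False
        then have "i \<in> K \<and> (s = \<sigma> i \<or> s = p i)" using x nz supp[of x i s] by (auto simp: c'_def)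
        then show ?thesis using j by auto
      qed
    qed
  qed (use KL NV j in auto)
  then show ?thesis by blast
qed

lemma spanning_subtree:
  assumes J: "J \<subseteq> L" "card J = card T" and b0: "b None = 0"
    and dragon: "\<And>J'. J' \<subseteq> J \<Longrightarrow> J' \<noteq> {} \<Longrightarrow> card J' < card {s. \<exists>j\<in>J'. tight b j s}"
  obtains \<sigma> p c where "subtree b R J \<sigma> p c"
proof -
  have finJ: "finite J" using J finite_L finite_subset by blast
  have "\<exists>V K \<sigma> p c. subtree b V K \<sigma> p c \<and> K \<subseteq> J \<and> card K = k" if "k \<le> card T" for k
    using that
  proof (induction k)
    case 0
    show ?case by (intro exI conjI, rule subtree_root[of b, OF b0]) auto
  next
    case (Suc k)
    then obtain V K \<sigma> p c where st: "subtree b V K \<sigma> p c" and K: "K \<subseteq> J" "card K = k"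
      using Suc.IH[OF Suc_leD] by blast
    have VR: "V \<subseteq> R" and cV: "card V = k + 1" using st K by (simp_all add: subtree_def)
    have finK: "finite K" using K finJ finite_subset by blast
    have ne: "J - K \<noteq> {}"
    proof
      assume "J - K = {}"
      then have "card J \<le> card K" using finK by (intro card_mono) auto
      then show False using K Suc.prems J by simp
    qed
    have "\<exists>j u v. j \<in> J - K \<and> u \<in> V \<and> tight b j u \<and> v \<notin> V \<and> tight b j v"
    proof (rule ccontr)
      assume no: "\<not> ?thesis"
      \<comment> \<open>A vertex of \<open>J - K\<close> touching \<open>V\<close> would have all
        its tight edges there. Two of them are excluded by \<open>subtree_tight\<close>, and fewer
        than two by the surplus condition for \<open>{j}\<close>.\<close>
      have out: "s \<notin> V" if j: "j \<in> J - K" and s: "tight b j s" for j s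
      proof
        assume sV: "s \<in> V"
        then have sub: "{s. tight b j s} \<subseteq> V" using no j s by blast
        have "1 < card {s. tight b j s}" using dragon[of "{j}"] j by simp
        moreover have "{s'. tight b j s'} \<subseteq> {s}"
          using subtree_tight[OF st, of j s] j J s sV sub by blast
        then have "card {s'. tight b j s'} \<le> card {s}" by (intro card_mono) auto
        ultimately show False by simp
      qed
      \<comment> \<open>The set \<open>R - V\<close> has exactly \<open>card (J - K)\<close>
        elements, too few for the surplus condition on \<open>J - K\<close>.\<close>
      have "{s. \<exists>j\<in>J - K. tight b j s} \<subseteq> R - V" using out tight_in_R by blast
      then have "card {s. \<exists>j\<in>J - K. tight b j s} \<le> card (R - V)"
        using finite_R by (intro card_mono) auto
      also have "\<dots> = card T - k"
        using VR cV card_R by (simp add: card_Diff_subset finite_subset[OF _ finite_R])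
      also have "\<dots> = card (J - K)" using K J finK by (simp add: card_Diff_subset)
      finally show False using dragon[of "J - K"] ne by simp
    qed
    then obtain j u v where *: "j \<in> J - K" "u \<in> V" "tight b j u" "v \<notin> V" "tight b j v" by blast
    then obtain c' where "subtree b (insert v V) (insert j K) (\<sigma>(j := v)) (p(j := u)) c'"
      using subtree_extend[OF st, of j u v] J by blast
    moreover have "insert j K \<subseteq> J" "card (insert j K) = Suc k" using * K finK by auto
    ultimately show ?case by blast
  qed
  from this[of "card T"] obtain V K \<sigma> p c
    where st: "subtree b V K \<sigma> p c" and K: "K \<subseteq> J" "card K = card T" by blast
  have "K = J" using K J finJ by (metis card_subset_eq)
  moreover have "V = R"
    using st K card_R finite_R by (intro card_subset_eq) (auto simp: subtree_def)
  ultimately show thesis using st that by blast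
qed

text \<open>What is kept of the spanning tree after orienting it towards the root. The paths to
  \<open>None\<close> make \<open>b\<close> the least potential for \<open>\<sigma>\<close>, the
  bound on \<open>b\<close> controls the edges at left vertices outside \<open>J\<close>, and the
  last clause recovers \<open>J\<close> from \<open>b\<close> and \<open>\<sigma>\<close>.\<close>

definition good :: "'a set \<Rightarrow> ('b option \<Rightarrow> int) \<Rightarrow> ('a \<Rightarrow> 'b option) \<Rightarrow> bool" where
  "good J b \<sigma> \<longleftrightarrow> b None = 0 \<and> (\<forall>j\<in>L. tight b j (\<sigma> j)) \<and> bij_betw \<sigma> J (Some ` T) \<and>
     (\<forall>v\<in>R. (v, None) \<in> {(\<sigma> j, s) | j s. j \<in> J \<and> tight b j s}\<^sup>*) \<and>
     (\<forall>v\<in>R. b v \<le> (\<Sum>j\<in>J. w (j, \<sigma> j))) \<and>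
     (\<forall>j\<in>L. j \<in> J \<longleftrightarrow> (\<exists>s. s \<noteq> \<sigma> j \<and> tight b j s))"

text \<open>Each vertex of \<open>J\<close> is assigned to its child end in the tree, any other left
  vertex to a tight target. That target is unique by \<open>subtree_tight\<close>, because the tree
  spans all of \<open>R\<close>.\<close>

lemma exists_good:
  assumes J: "J \<subseteq> L" "card J = card T"
  shows "\<exists>b \<sigma>. good J b \<sigma>"
proof -
  obtain b where b: "b None = 0"
    "\<And>J'. J' \<subseteq> J \<Longrightarrow> J' \<noteq> {} \<Longrightarrow> card J' < card {s. \<exists>j\<in>J'. tight b j s}"
    using exists_dragon_potential[OF J] by blast
  obtain \<sigma> p c where st: "subtree b R J \<sigma> p c" using spanning_subtree[OF J b] by blast
  define \<sigma>' where "\<sigma>' j = (if j \<in> J then \<sigma> j else (SOME s. tight b j s))" for j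
  have t': "tight b j (\<sigma>' j)" if "j \<in> L" for j
    using st that someI_ex[OF exists_tight, of b j] by (auto simp: \<sigma>'_def subtree_def)
  have "good J b \<sigma>'"
    unfolding good_def
  proof (intro conjI)
    have "R - {None} = Some ` T" by (auto simp: R_def)
    then show "bij_betw \<sigma>' J (Some ` T)"
      using st by (subst bij_betw_cong[of J _ \<sigma>]) (auto simp: subtree_def \<sigma>'_def)
    have sub: "{(\<sigma> j, p j) | j. j \<in> J} \<subseteq> {(\<sigma>' j, s) | j s. j \<in> J \<and> tight b j s}"
      using st by (fastforce simp: subtree_def \<sigma>'_def)
    show "\<forall>v\<in>R. (v, None) \<in> {(\<sigma>' j, s) | j s. j \<in> J \<and> tight b j s}\<^sup>*"
      using subtreeD(10)[OF st] rtrancl_mono[OF sub] by blast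
    show "\<forall>v\<in>R. b v \<le> (\<Sum>j\<in>J. w (j, \<sigma>' j))"
      using subtreeD(11)[OF st] by (simp add: \<sigma>'_def)
    show "\<forall>j\<in>L. j \<in> J \<longleftrightarrow> (\<exists>s. s \<noteq> \<sigma>' j \<and> tight b j s)"
    proof (intro ballI iffI)
      fix j assume "j \<in> L" "j \<in> J"
      then show "\<exists>s. s \<noteq> \<sigma>' j \<and> tight b j s"
        using st by (auto simp: subtree_def \<sigma>'_def)
    next
      fix j assume j: "j \<in> L" "\<exists>s. s \<noteq> \<sigma>' j \<and> tight b j s"
      then show "j \<in> J" using subtree_tight[OF st, of j _ "\<sigma>' j"] t' tight_in_R by blast
    qed
  qed (use b t' in auto)
  then show ?thesis by blast
qed

end

section \<open>Supports and perfect matchings\<close>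

definition pos_vectors :: "'b set \<Rightarrow> nat \<Rightarrow> ('b \<Rightarrow> nat) set" where
  "pos_vectors T m = {x \<in> T \<rightarrow>\<^sub>E UNIV. (\<forall>t\<in>T. 0 < x t) \<and> sum x T \<le> m}"

text \<open>Splitting off one entry turns the count into the hockey-stick identity for binomial
  coefficients. The result is the number of subsets of size \<open>card T\<close> of a set of size
  \<open>m\<close>.\<close>

lemma pos_vectors_card:
  fixes T :: "'b set"
  assumes "finite T"
  shows "finite (pos_vectors T m) \<and> card (pos_vectors T m) = m choose card T"
  using assms
proof (induction T arbitrary: m rule: finite_induct)
  case empty
  have "pos_vectors ({} :: 'b set) m = {\<lambda>_. undefined}" by (auto simp: pos_vectors_def)
  then show ?case by simp
next
  case (insert t T)
  let ?f = "\<lambda>(v, y). y(t := v)"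
  have "bij_betw ?f (SIGMA v:{1..m}. pos_vectors T (m - v)) (pos_vectors (insert t T) m)"
  proof (rule bij_betw_byWitness[where f' = "\<lambda>x. (x t, x(t := undefined))"])
    show "\<forall>a\<in>SIGMA v:{1..m}. pos_vectors T (m - v). ((?f a) t, (?f a)(t := undefined)) = a"
    proof
      fix a assume "a \<in> (SIGMA v:{1..m}. pos_vectors T (m - v))"
      then obtain v y where a: "a = (v, y)" "y \<in> pos_vectors T (m - v)" by blast
      then have "y t = undefined" using insert.hyps by (auto simp: pos_vectors_def PiE_def extensional_def)
      then show "((?f a) t, (?f a)(t := undefined)) = a" by (auto simp: a)
    qed
    show "\<forall>x\<in>pos_vectors (insert t T) m. ?f (x t, x(t := undefined)) = x" by auto
    show "?f ` (SIGMA v:{1..m}. pos_vectors T (m - v)) \<subseteq> pos_vectors (insert t T) m"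
    proof (rule image_subsetI)
      fix a assume "a \<in> (SIGMA v:{1..m}. pos_vectors T (m - v))"
      then obtain v y where a: "a = (v, y)" and *: "v \<in> {1..m}" "y \<in> pos_vectors T (m - v)" by blast
      have "sum (y(t := v)) T = sum y T" using insert.hyps by (intro sum.cong) auto
      then show "?f a \<in> pos_vectors (insert t T) m"
        using a * insert.hyps by (auto simp: pos_vectors_def PiE_def extensional_def)
    qed
    show "(\<lambda>x. (x t, x(t := undefined))) ` pos_vectors (insert t T) m
        \<subseteq> (SIGMA v:{1..m}. pos_vectors T (m - v))"
    proof (rule image_subsetI)
      fix x assume *: "x \<in> pos_vectors (insert t T) m"
      have "sum (x(t := undefined)) T = sum x T" using insert.hyps by (intro sum.cong) auto
      then show "(x t, x(t := undefined)) \<in> (SIGMA v:{1..m}. pos_vectors T (m - v))"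
        using * insert.hyps by (auto simp: pos_vectors_def PiE_def extensional_def)
    qed
  qed
  moreover have "card (SIGMA v:{1..m}. pos_vectors T (m - v)) = m choose card (insert t T)"
  proof -
    have "card (SIGMA v:{1..m}. pos_vectors T (m - v)) = (\<Sum>v\<in>{1..m}. (m - v) choose card T)"
      using insert.IH by (subst card_SigmaI) auto
    also have "\<dots> = (\<Sum>i<m. i choose card T)"
      by (rule sum.reindex_bij_witness[where i = "\<lambda>i. m - i" and j = "\<lambda>v. m - v"]) auto
    also have "\<dots> = m choose Suc (card T)"
    proof (cases m)
      case (Suc k)
      then show ?thesis using sum_choose_upper[of "card T" k] by (simp add: lessThan_Suc_atMost)
    qed simp
    finally show ?thesis using insert.hyps by simp
  qed
  moreover have "finite (SIGMA v:{1..m}. pos_vectors T (m - v))" using insert.IH by auto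
  ultimately show ?case by (metis bij_betw_finite bij_betw_same_card)
qed

section \<open>Degree vectors of tight assignments\<close>

context generic_weights begin

definition marg :: "('a \<Rightarrow> 'b option) \<Rightarrow> 'b \<Rightarrow> nat" where
  "marg \<sigma> = (\<lambda>t\<in>T. card {j \<in> L. \<sigma> j = Some t})"

lemma sum_marg:
  fixes b :: "'b option \<Rightarrow> int"
  assumes "\<sigma> ` L \<subseteq> R" "b None = 0"
  shows "(\<Sum>j\<in>L. b (\<sigma> j)) = (\<Sum>t\<in>T. int (marg \<sigma> t) * b (Some t))"
proof -
  have "(\<Sum>j\<in>L. b (\<sigma> j)) = (\<Sum>s\<in>R. \<Sum>j\<in>{j\<in>L. \<sigma> j = s}. b (\<sigma> j))"
    by (intro sum.group[symmetric] finite_L finite_R assms(1))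
  also have "\<dots> = (\<Sum>s\<in>R. int (card {j \<in> L. \<sigma> j = s}) * b s)"
    by (intro sum.cong) auto
  also have "\<dots> = (\<Sum>s\<in>Some ` T. int (card {j \<in> L. \<sigma> j = s}) * b s)"
    using finite_T assms(2) by (simp add: R_def image_iff)
  also have "\<dots> = (\<Sum>t\<in>T. int (card {j \<in> L. \<sigma> j = Some t}) * b (Some t))"
    by (subst sum.reindex) auto
  also have "\<dots> = (\<Sum>t\<in>T. int (marg \<sigma> t) * b (Some t))"
    by (simp add: marg_def)
  finally show ?thesis .
qed

text \<open>Weak duality: the potentials sum to a quantity depending on the degree vector only, and
  a tight assignment minimises each reduced cost separately.\<close>

lemma tight_min_cost:
  assumes b: "b None = 0" and \<sigma>: "\<forall>j\<in>L. tight b j (\<sigma> j)"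
    and \<sigma>': "\<sigma>' ` L \<subseteq> R" and eq: "marg \<sigma> = marg \<sigma>'"
  shows "(\<Sum>j\<in>L. w (j, \<sigma> j)) \<le> (\<Sum>j\<in>L. w (j, \<sigma>' j))"
proof -
  have "\<sigma> ` L \<subseteq> R" using \<sigma> tight_in_R by blast
  then have "(\<Sum>j\<in>L. b (\<sigma> j)) = (\<Sum>j\<in>L. b (\<sigma>' j))"
    using sum_marg b \<sigma>' eq by simp
  moreover have "(\<Sum>j\<in>L. w (j, \<sigma> j) - b (\<sigma> j)) \<le> (\<Sum>j\<in>L. w (j, \<sigma>' j) - b (\<sigma>' j))"
    using \<sigma> \<sigma>' by (intro sum_mono) (auto simp: tight_def)
  ultimately show ?thesis by (simp add: sum_subtractf)
qed

text \<open>The difference of the indicator functions of two assignments has coefficients in {-1, 0,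
  1}, so genericity separates their costs.\<close>

lemma cost_inj:
  assumes "\<sigma> ` L \<subseteq> R" "\<sigma>' ` L \<subseteq> R" and eq: "(\<Sum>j\<in>L. w (j, \<sigma> j)) = (\<Sum>j\<in>L. w (j, \<sigma>' j))"
    and j: "j \<in> L"
  shows "\<sigma> j = \<sigma>' j"
proof (rule ccontr)
  assume ne: "\<sigma> j \<noteq> \<sigma>' j"
  define c :: "'a \<times> 'b option \<Rightarrow> int" where
    "c e = of_bool (snd e = \<sigma> (fst e)) - of_bool (snd e = \<sigma>' (fst e))" for e
  have ind: "(\<Sum>e\<in>L \<times> R. of_bool (snd e = \<tau> (fst e)) * w e) = (\<Sum>j\<in>L. w (j, \<tau> j))"
    if "\<tau> ` L \<subseteq> R" for \<tau>
  proof -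
    have "(\<Sum>e\<in>L \<times> R. of_bool (snd e = \<tau> (fst e)) * w e)
        = (\<Sum>j\<in>L. \<Sum>s\<in>R. of_bool (s = \<tau> j) * w (j, s))"
      by (simp add: sum.cartesian_product case_prod_unfold)
    also have "\<dots> = (\<Sum>j\<in>L. w (j, \<tau> j))"
    proof (intro sum.cong refl)
      fix j assume "j \<in> L"
      then show "(\<Sum>s\<in>R. of_bool (s = \<tau> j) * w (j, s)) = w (j, \<tau> j)"
        using sum_of_bool_eq_mult[OF finite_R, of "\<tau> j" "\<lambda>s. w (j, s)"] that by auto
    qed
    finally show ?thesis .
  qed
  have "(\<Sum>e\<in>L \<times> R. c e * w e) = 0"
    unfolding c_def left_diff_distrib sum_subtractf using ind assms by simp
  moreover have "\<bar>c e\<bar> \<le> 3" for e by (simp add: c_def of_bool_def)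
  moreover have "(j, \<sigma> j) \<in> L \<times> R" using assms by auto
  ultimately have "c (j, \<sigma> j) = 0" using generic[of c "(j, \<sigma> j)"] by (simp add: R_def)
  then show False using ne by (simp add: c_def)
qed

lemma goodD:
  assumes "good J b \<sigma>"
  shows "b None = 0" "\<And>j. j \<in> L \<Longrightarrow> tight b j (\<sigma> j)" "bij_betw \<sigma> J (Some ` T)"
    "\<And>v. v \<in> R \<Longrightarrow> (v, None) \<in> {(\<sigma> j, s) | j s. j \<in> J \<and> tight b j s}\<^sup>*"
    "\<And>v. v \<in> R \<Longrightarrow> b v \<le> (\<Sum>j\<in>J. w (j, \<sigma> j))"
    "\<And>j. j \<in> L \<Longrightarrow> j \<in> J \<longleftrightarrow> (\<exists>s. s \<noteq> \<sigma> j \<and> tight b j s)"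
  using assms unfolding good_def by blast+

lemma good_image: "good J b \<sigma> \<Longrightarrow> \<sigma> ` L \<subseteq> R"
  using goodD(2) tight_in_R by blast

text \<open>Induction along the path from \<open>v\<close> to the root, where both potentials are 0.
  On a step from \<open>\<sigma> j\<close> to \<open>s\<close>, the drop of \<open>b\<close> equals
  the difference of the two weights, since both edges are tight; the drop of \<open>b'\<close> is at
  least that, since \<open>\<sigma> j\<close> is tight for \<open>b'\<close>.\<close>

lemma good_least:
  assumes g: "good J b \<sigma>" and J: "J \<subseteq> L" and b': "b' None = 0" "\<And>j. j \<in> L \<Longrightarrow> tight b' j (\<sigma> j)"
    and v: "v \<in> R"
  shows "b v \<le> b' v"
  using goodD(4)[OF g v]
proof (induction rule: converse_rtrancl_induct)
  case base
  then show ?case using goodD(1)[OF g] b' by simp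
next
  case (step v s)
  then obtain j where j: "j \<in> J" "v = \<sigma> j" "tight b j s" by blast
  then have "w (j, v) - b v = w (j, s) - b s" using tight_eq goodD(2)[OF g] J by blast
  moreover have "w (j, v) - b' v \<le> w (j, s) - b' s"
    using b'(2)[of j] j J tight_in_R[OF j(3)] by (auto simp: tight_def)
  ultimately show ?case using step.IH by simp
qed

text \<open>Both assignments are cheapest for the common degree vector, hence equal on
  \<open>L\<close>. Both potentials are then least for the same assignment, so they agree on
  \<open>R\<close>, and \<open>J\<close> is the set of left vertices with a second tight
  edge.\<close>

lemma good_marg_inj:
  assumes g: "good J b \<sigma>" "good J' b' \<sigma>'" and J: "J \<subseteq> L" "J' \<subseteq> L" and eq: "marg \<sigma> = marg \<sigma>'"
  shows "J = J'"
proof -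
  note im = good_image[OF g(1)] good_image[OF g(2)]
  have "(\<Sum>j\<in>L. w (j, \<sigma> j)) \<le> (\<Sum>j\<in>L. w (j, \<sigma>' j))"
    using goodD(2)[OF g(1)] im eq by (intro tight_min_cost[of b, OF goodD(1)[OF g(1)]]) auto
  moreover have "(\<Sum>j\<in>L. w (j, \<sigma>' j)) \<le> (\<Sum>j\<in>L. w (j, \<sigma> j))"
    using goodD(2)[OF g(2)] im eq by (intro tight_min_cost[of b', OF goodD(1)[OF g(2)]]) auto
  ultimately have "(\<Sum>j\<in>L. w (j, \<sigma> j)) = (\<Sum>j\<in>L. w (j, \<sigma>' j))"
    by (rule antisym)
  then have s: "\<sigma> j = \<sigma>' j" if "j \<in> L" for j using cost_inj im that by blast
  have "b v = b' v" if "v \<in> R" for v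
  proof (rule antisym)
    show "b v \<le> b' v"
    proof (rule good_least[OF g(1) J(1) _ _ that])
      show "tight b' j (\<sigma> j)" if "j \<in> L" for j using goodD(2)[OF g(2) that] s[OF that] by simp
    qed (rule goodD(1)[OF g(2)])
    show "b' v \<le> b v"
    proof (rule good_least[OF g(2) J(2) _ _ that])
      show "tight b j (\<sigma>' j)" if "j \<in> L" for j using goodD(2)[OF g(1) that] s[OF that] by simp
    qed (rule goodD(1)[OF g(1)])
  qed
  then have "tight b = tight b'" by (auto simp: tight_def fun_eq_iff)
  then have "j \<in> J \<longleftrightarrow> j \<in> J'" if "j \<in> L" for j
    using goodD(6)[OF g(1) that] goodD(6)[OF g(2) that] s[OF that] by simp
  then show ?thesis using J by blast
qed

lemma sum_marg_le: "\<sigma> ` L \<subseteq> R \<Longrightarrow> (\<Sum>t\<in>T. marg \<sigma> t) \<le> card L"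
proof -
  have "(\<Sum>t\<in>T. marg \<sigma> t) = (\<Sum>t\<in>T. card {j \<in> L. \<sigma> j = Some t})" by (simp add: marg_def)
  also have "\<dots> = card (\<Union>t\<in>T. {j \<in> L. \<sigma> j = Some t})"
    using finite_L finite_T by (subst card_UN_disjoint) auto
  also have "\<dots> \<le> card L" using finite_L by (intro card_mono) auto
  finally show ?thesis .
qed

lemma good_marg_pos:
  assumes g: "good J b \<sigma>" and J: "J \<subseteq> L"
  shows "marg \<sigma> \<in> pos_vectors T (card L)"
proof -
  have "0 < marg \<sigma> t" if "t \<in> T" for t
  proof -
    have "Some t \<in> \<sigma> ` J" using goodD(3)[OF g] that by (auto simp: bij_betw_def)
    then have "{j \<in> L. \<sigma> j = Some t} \<noteq> {}" using J by force
    then show ?thesis using that finite_L by (simp add: marg_def card_gt_0_iff)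
  qed
  then show ?thesis using sum_marg_le[OF good_image[OF g]] by (auto simp: pos_vectors_def marg_def)
qed

text \<open>The map is injective by \<open>good_marg_inj\<close>, and both sides have
  \<open>card L choose card T\<close> elements.\<close>

lemma good_bij:
  obtains S where "\<And>J. J \<subseteq> L \<Longrightarrow> card J = card T \<Longrightarrow> \<exists>b. good J b (S J)"
    "bij_betw (\<lambda>J. marg (S J)) {J. J \<subseteq> L \<and> card J = card T} (pos_vectors T (card L))"
proof -
  define Js where "Js = {J. J \<subseteq> L \<and> card J = card T}"
  have "\<forall>J\<in>Js. \<exists>\<sigma>. \<exists>b. good J b \<sigma>" using exists_good unfolding Js_def by blast
  then obtain S where S: "\<And>J. J \<in> Js \<Longrightarrow> \<exists>b. good J b (S J)" by metis
  have inj: "inj_on (\<lambda>J. marg (S J)) Js"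
  proof (rule inj_onI)
    fix J J' assume J: "J \<in> Js" "J' \<in> Js" and eq: "marg (S J) = marg (S J')"
    obtain b b' where "good J b (S J)" "good J' b' (S J')" using S J by blast
    then show "J = J'" using good_marg_inj eq J by (auto simp: Js_def)
  qed
  then have "card ((\<lambda>J. marg (S J)) ` Js) = card (pos_vectors T (card L))"
    using pos_vectors_card[OF finite_T] n_subsets[OF finite_L] by (simp add: card_image Js_def)
  moreover have "(\<lambda>J. marg (S J)) ` Js \<subseteq> pos_vectors T (card L)"
    using S good_marg_pos by (auto simp: Js_def)
  ultimately have "(\<lambda>J. marg (S J)) ` Js = pos_vectors T (card L)"
    using pos_vectors_card[OF finite_T] by (intro card_subset_eq) auto
  then show thesis using that[of S] S inj by (auto simp: Js_def bij_betw_def)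
qed

end

section \<open>Forbidding edges by heavy weights\<close>

locale heavy_weights = generic_weights +
  fixes A :: "('a \<times> 'b option) set"
  assumes A_sub: "A \<subseteq> L \<times> R" and A_None: "j \<in> L \<Longrightarrow> (j, None) \<in> A"
    and heavy: "e \<in> L \<times> R \<Longrightarrow> e \<notin> A \<Longrightarrow> (\<Sum>e\<in>A. w e) < w e"
begin

lemma finite_A: "finite A"
  using A_sub finite_L finite_R by (meson finite_SigmaI finite_subset)

lemma light_sum:
  assumes "\<And>j. j \<in> J \<Longrightarrow> (j, \<tau> j) \<in> A"
  shows "(\<Sum>j\<in>J. w (j, \<tau> j)) \<le> (\<Sum>e\<in>A. w e)"
proof -
  have "(\<Sum>j\<in>J. w (j, \<tau> j)) = (\<Sum>e\<in>(\<lambda>j. (j, \<tau> j)) ` J. w e)"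
    by (subst sum.reindex) (auto simp: inj_on_def)
  also have "\<dots> \<le> (\<Sum>e\<in>A. w e)"
    using assms finite_A w_nonneg by (intro sum_mono2) auto
  finally show ?thesis .
qed

lemma light_in_A:
  assumes le: "(\<Sum>j\<in>J. w (j, \<tau> j)) \<le> (\<Sum>e\<in>A. w e)" and J: "J \<subseteq> L" "\<tau> ` J \<subseteq> R" and j: "j \<in> J"
  shows "(j, \<tau> j) \<in> A"
proof (rule ccontr)
  assume "(j, \<tau> j) \<notin> A"
  then have "(\<Sum>e\<in>A. w e) < w (j, \<tau> j)" using J j by (intro heavy) auto
  also have "\<dots> \<le> (\<Sum>j\<in>J. w (j, \<tau> j))"
    using j J finite_L finite_subset w_nonneg by (intro member_le_sum) auto
  finally show False using le by simp
qed

text \<open>From left to right, \<open>\<sigma>\<close> itself matches \<open>J\<close> to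
  \<open>T\<close>. Conversely, \<open>\<mu>\<close> and \<open>\<sigma>\<close> both cover
  \<open>T\<close> exactly once from \<open>J\<close>, so the potentials cancel and
  \<open>\<sigma>\<close> costs no more on \<open>J\<close> than \<open>\<mu>\<close>, which is too
  little for an edge outside \<open>A\<close>. The remaining left vertices are compared with their
  root edges.\<close>

lemma good_in_A_iff_matched:
  assumes g: "good J b \<sigma>" and J: "J \<subseteq> L"
  shows "(\<forall>j\<in>L. (j, \<sigma> j) \<in> A) \<longleftrightarrow> (\<exists>\<mu>. bij_betw \<mu> J T \<and> (\<forall>j\<in>J. (j, Some (\<mu> j)) \<in> A))"
proof (intro iffI ballI)
  assume A: "\<forall>j\<in>L. (j, \<sigma> j) \<in> A"
  have "bij_betw (the \<circ> \<sigma>) J T"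
    using goodD(3)[OF g] by (rule bij_betw_trans) (auto simp: bij_betw_def inj_on_def image_image)
  moreover have "Some (the (\<sigma> j)) = \<sigma> j" if "j \<in> J" for j
    using bij_betwE[OF goodD(3)[OF g]] that by auto
  ultimately show "\<exists>\<mu>. bij_betw \<mu> J T \<and> (\<forall>j\<in>J. (j, Some (\<mu> j)) \<in> A)"
    using A J by (intro exI[of _ "the \<circ> \<sigma>"]) auto
next
  fix j assume "\<exists>\<mu>. bij_betw \<mu> J T \<and> (\<forall>j\<in>J. (j, Some (\<mu> j)) \<in> A)" and j: "j \<in> L"
  then obtain \<mu> where \<mu>: "bij_betw \<mu> J T" "\<And>j. j \<in> J \<Longrightarrow> (j, Some (\<mu> j)) \<in> A" by blast
  have "bij_betw (Some \<circ> \<mu>) J (Some ` T)"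
    using \<mu>(1) by (rule bij_betw_trans) (auto simp: bij_betw_def)
  then have "(\<Sum>j\<in>J. b (Some (\<mu> j))) = (\<Sum>s\<in>Some ` T. b s)"
    using sum.reindex_bij_betw[of "Some \<circ> \<mu>" J _ b] by simp
  also have "\<dots> = (\<Sum>j\<in>J. b (\<sigma> j))"
    using sum.reindex_bij_betw[OF goodD(3)[OF g], of b] by simp
  finally have sb: "(\<Sum>j\<in>J. b (Some (\<mu> j))) = (\<Sum>j\<in>J. b (\<sigma> j))" .
  have "(\<Sum>j\<in>J. w (j, \<sigma> j) - b (\<sigma> j)) \<le> (\<Sum>j\<in>J. w (j, Some (\<mu> j)) - b (Some (\<mu> j)))"
  proof (intro sum_mono)
    fix i assume i: "i \<in> J"
    then have "Some (\<mu> i) \<in> R" using \<mu> A_sub by blast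
    then show "w (i, \<sigma> i) - b (\<sigma> i) \<le> w (i, Some (\<mu> i)) - b (Some (\<mu> i))"
      using goodD(2)[OF g, of i] i J by (auto simp: tight_def)
  qed
  then have "(\<Sum>j\<in>J. w (j, \<sigma> j)) \<le> (\<Sum>j\<in>J. w (j, Some (\<mu> j)))"
    using sb by (simp add: sum_subtractf)
  also have "\<dots> \<le> (\<Sum>e\<in>A. w e)" using \<mu>(2) by (intro light_sum)
  finally have JA: "(i, \<sigma> i) \<in> A" if "i \<in> J" for i
    using light_in_A[of \<sigma> J] J good_image[OF g] that by blast
  show "(j, \<sigma> j) \<in> A"
  proof (cases "j \<in> J")
    case False
    \<comment> \<open>Since the root has potential 0, the edge at \<open>j\<close> exceeds its root
      edge by at most \<open>b (\<sigma> j)\<close>, which is bounded by the cost of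
      \<open>\<sigma>\<close> on \<open>J\<close>.\<close>
    have "w (j, \<sigma> j) - b (\<sigma> j) \<le> w (j, None) - b None"
      using goodD(2)[OF g j] None_in_R by (auto simp: tight_def)
    moreover have "b (\<sigma> j) \<le> (\<Sum>i\<in>J. w (i, \<sigma> i))"
      using goodD(5)[OF g] good_image[OF g] j by blast
    ultimately have "w (j, \<sigma> j) \<le> w (j, None) + (\<Sum>i\<in>J. w (i, \<sigma> i))"
      using goodD(1)[OF g] by simp
    \<comment> \<open>The root edge of \<open>j\<close> and the edges on \<open>J\<close> are
      distinct elements of \<open>A\<close>, so together they are still light.\<close>
    also have "\<dots> = (\<Sum>i\<in>insert j J. w (i, (\<sigma>(j := None)) i))"
    proof -
      have "(\<Sum>i\<in>J. w (i, (\<sigma>(j := None)) i)) = (\<Sum>i\<in>J. w (i, \<sigma> i))"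
        using False by (intro sum.cong) auto
      then show ?thesis using False J finite_L finite_subset by (subst sum.insert) auto
    qed
    also have "\<dots> \<le> (\<Sum>e\<in>A. w e)" using JA A_None j by (intro light_sum) auto
    finally have "\<not> (\<Sum>e\<in>A. w e) < w (j, \<sigma> j)" by simp
    moreover have "(j, \<sigma> j) \<in> L \<times> R" using good_image[OF g] j by blast
    ultimately show ?thesis using heavy by blast
  qed (use JA in blast)
qed

text \<open>Some assignment within \<open>A\<close> with this degree vector bounds the cost of the
  cheapest one, \<open>\<sigma>\<close>, by the total weight of \<open>A\<close>; a single edge
  outside \<open>A\<close> would exceed it.\<close>

lemma good_in_A_iff_assignable:
  assumes g: "good J b \<sigma>"
  shows "(\<forall>j\<in>L. (j, \<sigma> j) \<in> A) \<longleftrightarrow> (\<exists>\<sigma>'. (\<forall>j\<in>L. (j, \<sigma>' j) \<in> A) \<and> marg \<sigma>' = marg \<sigma>)"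
proof (intro iffI)
  assume "\<exists>\<sigma>'. (\<forall>j\<in>L. (j, \<sigma>' j) \<in> A) \<and> marg \<sigma>' = marg \<sigma>"
  then obtain \<sigma>' where \<sigma>': "\<And>j. j \<in> L \<Longrightarrow> (j, \<sigma>' j) \<in> A" "marg \<sigma>' = marg \<sigma>" by blast
  then have "\<sigma>' ` L \<subseteq> R" using A_sub by blast
  then have "(\<Sum>j\<in>L. w (j, \<sigma> j)) \<le> (\<Sum>j\<in>L. w (j, \<sigma>' j))"
    using goodD(2)[OF g] \<sigma>'(2) by (intro tight_min_cost[of b, OF goodD(1)[OF g]]) auto
  also have "\<dots> \<le> (\<Sum>e\<in>A. w e)" using \<sigma>' by (intro light_sum)
  finally show "\<forall>j\<in>L. (j, \<sigma> j) \<in> A" using light_in_A good_image[OF g] by blast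
qed blast

text \<open>The bijection of \<open>good_bij\<close> for the complete graph restricts to the two
  sets: on either side, the condition says that the tight assignment stays within
  \<open>A\<close>.\<close>

lemma card_assignable_eq_card_matched:
  "card {x. (\<forall>t\<in>T. 0 < x t) \<and> (\<exists>\<sigma>. (\<forall>j\<in>L. (j, \<sigma> j) \<in> A) \<and> marg \<sigma> = x)}
   = card {J. J \<subseteq> L \<and> (\<exists>\<mu>. bij_betw \<mu> J T \<and> (\<forall>j\<in>J. (j, Some (\<mu> j)) \<in> A))}" (is "card ?X = card ?M")
proof -
  obtain S where S: "\<And>J. J \<subseteq> L \<Longrightarrow> card J = card T \<Longrightarrow> \<exists>b. good J b (S J)"
    and bij: "bij_betw (\<lambda>J. marg (S J)) {J. J \<subseteq> L \<and> card J = card T} (pos_vectors T (card L))"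
    using good_bij by blast
  have M: "J \<subseteq> L \<and> card J = card T" if "J \<in> ?M" for J
    using that by (auto dest: bij_betw_same_card)
  have "(\<lambda>J. marg (S J)) ` ?M = ?X"
  proof safe
    fix J \<mu> assume J: "J \<subseteq> L" and \<mu>: "bij_betw \<mu> J T" "\<forall>j\<in>J. (j, Some (\<mu> j)) \<in> A"
    then obtain b where g: "good J b (S J)" using S bij_betw_same_card by blast
    show "0 < marg (S J) t" if "t \<in> T" for t
      using good_marg_pos[OF g J] that by (simp add: pos_vectors_def)
    show "\<exists>\<sigma>. (\<forall>j\<in>L. (j, \<sigma> j) \<in> A) \<and> marg \<sigma> = marg (S J)"
      using good_in_A_iff_matched[OF g J] \<mu> by blast
  next
    fix x \<sigma> assume pos: "\<forall>t\<in>T. 0 < marg \<sigma> t" and \<sigma>: "\<forall>j\<in>L. (j, \<sigma> j) \<in> A"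
    have "\<sigma> ` L \<subseteq> R" using \<sigma> A_sub by blast
    then have "marg \<sigma> \<in> pos_vectors T (card L)"
      using pos sum_marg_le by (auto simp: pos_vectors_def marg_def)
    then have "marg \<sigma> \<in> (\<lambda>J. marg (S J)) ` {J. J \<subseteq> L \<and> card J = card T}"
      using bij by (simp add: bij_betw_def)
    then obtain J where J: "J \<subseteq> L" "card J = card T" and eq: "marg \<sigma> = marg (S J)" by blast
    obtain b where g: "good J b (S J)" using S J by blast
    have "\<forall>j\<in>L. (j, S J j) \<in> A"
      using good_in_A_iff_assignable[OF g] \<sigma> eq by metis
    then have "J \<in> ?M" using good_in_A_iff_matched[OF g J(1)] J(1) by blast
    then show "marg \<sigma> \<in> (\<lambda>J. marg (S J)) ` ?M" using eq by (metis (no_types, lifting) image_eqI)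
  qed
  moreover have "?M \<subseteq> {J. J \<subseteq> L \<and> card J = card T}" using M by blast
  then have "card ((\<lambda>J. marg (S J)) ` ?M) = card ?M"
    by (intro card_image inj_on_subset[OF bij_betw_imp_inj_on[OF bij]])
  ultimately show ?thesis by simp
qed

end

section \<open>Existence of generic heavy weights\<close>

lemma base8_digits_zero:
  fixes c :: "'e \<Rightarrow> int"
  assumes fin: "finite F" and inj: "inj_on idx F" and c: "\<And>e. \<bar>c e\<bar> \<le> 3"
    and sum: "(\<Sum>e\<in>F. c e * 8 ^ idx e) = 0" and e: "e \<in> F"
  shows "c e = 0"
proof (rule ccontr)
  assume "c e \<noteq> 0"
  define F' where "F' = {e \<in> F. c e \<noteq> 0}"
  have F': "finite F'" "F' \<noteq> {}" using fin e \<open>c e \<noteq> 0\<close> by (auto simp: F'_def)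
  \<comment> \<open>At the least exponent with a nonzero digit, all other terms are divisible by the
    next power of 8. So 8 divides this digit, which has absolute value at most 3.\<close>
  obtain e0 where e0: "e0 \<in> F'" "\<And>e. e \<in> F' \<Longrightarrow> idx e0 \<le> idx e"
    using ex_has_least_nat[of "\<lambda>e. e \<in> F'" _ idx] F'(2) by (metis ex_in_conv)
  have "(\<Sum>e\<in>F. c e * 8 ^ idx e) = (\<Sum>e\<in>F'. c e * 8 ^ idx e)"
    unfolding F'_def using fin by (intro sum.mono_neutral_right) auto
  also have "\<dots> = c e0 * 8 ^ idx e0 + (\<Sum>e\<in>F' - {e0}. c e * 8 ^ idx e)"
    using F' e0 by (simp add: sum.remove)
  finally have eq: "c e0 * 8 ^ idx e0 = - (\<Sum>e\<in>F' - {e0}. c e * 8 ^ idx e)" using sum by simp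
  have "8 ^ Suc (idx e0) dvd (\<Sum>e\<in>F' - {e0}. c e * 8 ^ idx e)"
  proof (rule dvd_sum)
    fix e assume e: "e \<in> F' - {e0}"
    then have "idx e \<noteq> idx e0" using inj e0 by (auto simp: F'_def inj_on_def)
    then have "Suc (idx e0) \<le> idx e" using e0(2)[of e] e by simp
    then show "8 ^ Suc (idx e0) dvd c e * 8 ^ idx e" by (intro dvd_mult le_imp_power_dvd)
  qed
  then have "8 ^ Suc (idx e0) dvd c e0 * 8 ^ idx e0" unfolding eq by simp
  then have "8 dvd c e0" by simp
  then have "c e0 = 0" using c[of e0] by presburger
  then show False using e0 by (simp add: F'_def)
qed

lemma sum_base8_less:
  assumes "inj_on idx A" "idx ` A \<subseteq> {..<n}"
  shows "(\<Sum>e\<in>A. 8 ^ idx e) < (8::int) ^ n"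
proof -
  have geo: "7 * (\<Sum>i<n. (8::int) ^ i) = 8 ^ n - 1" by (induction n) auto
  have "(\<Sum>e\<in>A. (8::int) ^ idx e) = (\<Sum>i\<in>idx ` A. 8 ^ i)"
    using assms by (simp add: sum.reindex)
  also have "\<dots> \<le> (\<Sum>i<n. 8 ^ i)" using assms by (intro sum_mono2) auto
  also have "\<dots> < 8 ^ n" using geo zero_less_power[of "8::int" n] by linarith
  finally show ?thesis .
qed

text \<open>Distinct powers of 8 are generic. Exponents below \<open>card A\<close> go to the edges
  in \<open>A\<close>, so every other edge outweighs the geometric sum over
  \<open>A\<close>.\<close>

lemma exists_heavy_weights:
  assumes L: "finite L" and T: "finite T"
    and A: "A \<subseteq> L \<times> insert None (Some ` T)" "\<And>j. j \<in> L \<Longrightarrow> (j, None) \<in> A"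
  obtains w where "heavy_weights L T w A"
proof -
  define F where "F = L \<times> insert None (Some ` T)"
  have fin: "finite F" "finite A" using L T A by (auto simp: F_def intro: finite_subset)
  obtain h1 where h1: "bij_betw h1 A {0..<card A}"
    using ex_bij_betw_finite_nat fin by blast
  obtain h2 where h2: "bij_betw h2 (F - A) {0..<card (F - A)}"
    using ex_bij_betw_finite_nat fin by blast
  define idx where "idx e = (if e \<in> A then h1 e else card A + h2 e)" for e
  have "h1 e < card A" if "e \<in> A" for e using bij_betwE[OF h1] that by auto
  then have inj: "inj_on idx F"
    using bij_betw_imp_inj_on[OF h1] bij_betw_imp_inj_on[OF h2]
    by (fastforce simp: inj_on_def idx_def)
  have low: "inj_on idx A" "idx ` A \<subseteq> {..<card A}"
    using h1 by (auto simp: idx_def bij_betw_def inj_on_def)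
  interpret generic_weights L T "\<lambda>e. 8 ^ idx e"
    by unfold_locales (use L T base8_digits_zero[OF fin(1) inj] in \<open>auto simp: F_def\<close>)
  have "heavy_weights L T (\<lambda>e. 8 ^ idx e) A"
  proof unfold_locales
    show "A \<subseteq> L \<times> R" using A by (simp add: R_def)
    fix e assume "e \<in> L \<times> R" "e \<notin> A"
    then have "(8::int) ^ card A \<le> 8 ^ idx e" by (intro power_increasing) (auto simp: idx_def)
    with sum_base8_less[OF low] show "(\<Sum>e\<in>A. 8 ^ idx e) < (8::int) ^ idx e"
      by (rule order.strict_trans2)
  qed (use A in auto)
  then show thesis by (rule that)
qed

section \<open>Degree vectors and the exchange of the two sides\<close>

text \<open>Degree vectors on the right side of the subgraphs of \<open>E\<close> in which every left vertex has
  degree at most one.\<close>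

definition degree_vectors :: "('a \<times> 'b) set \<Rightarrow> 'a set \<Rightarrow> 'b set \<Rightarrow> ('b \<Rightarrow> nat) set" where
  "degree_vectors E L T = {x \<in> T \<rightarrow>\<^sub>E UNIV. \<exists>\<sigma>.
     (\<forall>j\<in>L. \<forall>t. \<sigma> j = Some t \<longrightarrow> t \<in> T \<and> (j, t) \<in> E) \<and> (\<forall>t\<in>T. card {j \<in> L. \<sigma> j = Some t} = x t)}"

definition matched :: "('a \<times> 'b) set \<Rightarrow> 'a set \<Rightarrow> 'b set \<Rightarrow> bool" where
  "matched E J T \<longleftrightarrow> (\<exists>\<mu>. bij_betw \<mu> J T \<and> (\<forall>j\<in>J. (j, \<mu> j) \<in> E))"

text \<open>The allowed set \<open>A\<close> consists of the edges into \<open>T\<close> and all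
  root edges; assigning a left vertex to the root means leaving it isolated.\<close>

lemma card_positive_degree_vectors:
  fixes L :: "'a set" and T :: "'b set"
  assumes L: "finite L" and T: "finite T"
  shows "card {x \<in> degree_vectors E L T. \<forall>t\<in>T. 0 < x t} = card {J. J \<subseteq> L \<and> matched E J T}"
proof -
  define A where "A = L \<times> {None} \<union> {(j, Some t) | j t. j \<in> L \<and> t \<in> T \<and> (j, t) \<in> E}"
  obtain w where "heavy_weights L T w A"
    using exists_heavy_weights[OF L T, of A] by (auto simp: A_def)
  then interpret heavy_weights L T w A .
  have A_iff: "(j, s) \<in> A \<longleftrightarrow> (\<forall>t. s = Some t \<longrightarrow> t \<in> T \<and> (j, t) \<in> E)" if "j \<in> L" for j s
    using that by (cases s) (auto simp: A_def)
  have A_iff': "(\<forall>j\<in>L. (j, \<sigma> j) \<in> A) \<longleftrightarrow>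
      (\<forall>j\<in>L. \<forall>t. \<sigma> j = Some t \<longrightarrow> t \<in> T \<and> (j, t) \<in> E)" for \<sigma>
    by (intro ball_cong refl A_iff)
  have marg_iff: "marg \<sigma> = x \<longleftrightarrow> x \<in> T \<rightarrow>\<^sub>E UNIV \<and> (\<forall>t\<in>T. card {j \<in> L. \<sigma> j = Some t} = x t)" for \<sigma> x
    by (auto simp: marg_def fun_eq_iff PiE_def extensional_def)
  have "{x \<in> degree_vectors E L T. \<forall>t\<in>T. 0 < x t}
      = {x. (\<forall>t\<in>T. 0 < x t) \<and> (\<exists>\<sigma>. (\<forall>j\<in>L. (j, \<sigma> j) \<in> A) \<and> marg \<sigma> = x)}"
    unfolding degree_vectors_def A_iff' marg_iff by blast
  moreover have "{J. J \<subseteq> L \<and> matched E J T}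
      = {J. J \<subseteq> L \<and> (\<exists>\<mu>. bij_betw \<mu> J T \<and> (\<forall>j\<in>J. (j, Some (\<mu> j)) \<in> A))}"
  proof (intro Collect_cong conj_cong refl)
    fix J assume "J \<subseteq> L"
    then have "bij_betw \<mu> J T \<and> (\<forall>j\<in>J. (j, \<mu> j) \<in> E) \<longleftrightarrow>
        bij_betw \<mu> J T \<and> (\<forall>j\<in>J. (j, Some (\<mu> j)) \<in> A)" for \<mu>
      using A_iff by (auto simp: bij_betw_def)
    then show "matched E J T \<longleftrightarrow> (\<exists>\<mu>. bij_betw \<mu> J T \<and> (\<forall>j\<in>J. (j, Some (\<mu> j)) \<in> A))"
      by (simp add: matched_def)
  qed
  ultimately show ?thesis using card_assignable_eq_card_matched by simp
qed

lemma matched_converse: "matched (E\<inverse>) T J \<longleftrightarrow> matched E J T"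
proof -
  have "matched (E\<inverse>) T J" if m: "matched E J T" for E :: "('x \<times> 'y) set" and J T
  proof -
    obtain \<mu> where \<mu>: "bij_betw \<mu> J T" "\<forall>j\<in>J. (j, \<mu> j) \<in> E" using m unfolding matched_def by blast
    have "(t, inv_into J \<mu> t) \<in> E\<inverse>" if "t \<in> T" for t
    proof -
      have "t \<in> \<mu> ` J" using \<mu>(1) that by (simp add: bij_betw_def)
      then have "\<mu> (inv_into J \<mu> t) = t" "inv_into J \<mu> t \<in> J"
        by (simp_all add: f_inv_into_f inv_into_into)
      then show ?thesis using \<mu>(2) by force
    qed
    then show ?thesis using bij_betw_inv_into[OF \<mu>(1)] by (auto simp: matched_def)
  qed
  from this[of E J T] this[of "E\<inverse>" T J] show ?thesis by auto
qed

lemma matched_card: "matched E J T \<Longrightarrow> card J = card T"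
  by (auto simp: matched_def bij_betw_same_card)

lemma degree_vectors_le:
  assumes "finite L" "x \<in> degree_vectors E L T" "t \<in> T"
  shows "x t \<le> card L"
proof -
  obtain \<sigma> where "card {j \<in> L. \<sigma> j = Some t} = x t" using assms by (auto simp: degree_vectors_def)
  moreover have "card {j \<in> L. \<sigma> j = Some t} \<le> card L" using assms by (intro card_mono) auto
  ultimately show ?thesis by simp
qed

lemma finite_degree_vectors:
  assumes "finite L" "finite T"
  shows "finite (degree_vectors E L T)"
proof (rule finite_subset)
  show "degree_vectors E L T \<subseteq> T \<rightarrow>\<^sub>E {..card L}"
  proof
    fix x assume x: "x \<in> degree_vectors E L T"
    then have "x \<in> T \<rightarrow>\<^sub>E UNIV" by (simp add: degree_vectors_def)
    then show "x \<in> T \<rightarrow>\<^sub>E {..card L}"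
      using degree_vectors_le[OF assms(1) x] by (auto simp: PiE_def extensional_def)
  qed
qed (use assms in \<open>auto intro: finite_PiE\<close>)

text \<open>A left vertex assigned to \<open>t\<close> makes the degree of \<open>t\<close>
  positive, so a subgraph with support \<open>S\<close> never uses \<open>T - S\<close>. Restriction
  to \<open>S\<close> and extension by 0 are mutually inverse.\<close>

lemma card_degree_vectors_support:
  assumes L: "finite L" and S: "S \<subseteq> T"
  shows "card {x \<in> degree_vectors E L T. {t \<in> T. 0 < x t} = S}
    = card {x \<in> degree_vectors E L S. \<forall>t\<in>S. 0 < x t}"
proof (rule bij_betw_same_card)
  let ?X = "{x \<in> degree_vectors E L T. {t \<in> T. 0 < x t} = S}"
  let ?Y = "{x \<in> degree_vectors E L S. \<forall>t\<in>S. 0 < x t}"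
  define g where "g = (\<lambda>y::'b \<Rightarrow> nat. \<lambda>t. if t \<in> S then y t else if t \<in> T then 0 else undefined)"
  have X: "x t = 0 \<longleftrightarrow> t \<notin> S" if "x \<in> ?X" "t \<in> T" for x t using that by auto
  have r: "restrict x S \<in> ?Y" if x: "x \<in> ?X" for x
  proof -
    have "x \<in> degree_vectors E L T" using x by blast
    then obtain \<sigma> where \<sigma>: "\<And>j t. j \<in> L \<Longrightarrow> \<sigma> j = Some t \<Longrightarrow> t \<in> T \<and> (j, t) \<in> E"
      "\<And>t. t \<in> T \<Longrightarrow> card {j \<in> L. \<sigma> j = Some t} = x t"
      unfolding degree_vectors_def by blast
    have "t \<in> S \<and> (j, t) \<in> E" if "j \<in> L" "\<sigma> j = Some t" for j t
    proof -
      have "card {j \<in> L. \<sigma> j = Some t} \<noteq> 0" using L that by auto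
      then show ?thesis using \<sigma>(1)[OF that] \<sigma>(2)[of t] X[OF x, of t] by auto
    qed
    then have "restrict x S \<in> degree_vectors E L S"
      using \<sigma>(2) S unfolding degree_vectors_def by (auto intro!: exI[of _ \<sigma>])
    then show ?thesis using x by auto
  qed
  have e: "g y \<in> ?X" if y: "y \<in> ?Y" for y
  proof -
    have "y \<in> degree_vectors E L S" using y by blast
    then obtain \<sigma> where \<sigma>: "\<And>j t. j \<in> L \<Longrightarrow> \<sigma> j = Some t \<Longrightarrow> t \<in> S \<and> (j, t) \<in> E"
      "\<And>t. t \<in> S \<Longrightarrow> card {j \<in> L. \<sigma> j = Some t} = y t"
      unfolding degree_vectors_def by blast
    have "card {j \<in> L. \<sigma> j = Some t} = g y t" if "t \<in> T" for t
    proof (cases "t \<in> S")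
      case False
      then have "{j \<in> L. \<sigma> j = Some t} = {}" using \<sigma>(1) by blast
      then show ?thesis using False that by (simp only: g_def) simp
    qed (use \<sigma>(2) in \<open>simp add: g_def\<close>)
    moreover have "t \<in> T \<and> (j, t) \<in> E" if "j \<in> L" "\<sigma> j = Some t" for j t
      using \<sigma>(1)[OF that] S by blast
    moreover have "g y \<in> T \<rightarrow>\<^sub>E UNIV" using S by (auto simp: g_def PiE_def extensional_def)
    ultimately have "g y \<in> degree_vectors E L T"
      unfolding degree_vectors_def by (auto intro!: exI[of _ \<sigma>])
    moreover have "{t \<in> T. 0 < g y t} = S" using y S by (auto simp: g_def)
    ultimately show ?thesis by blast
  qed
  show "bij_betw (\<lambda>x. restrict x S) ?X ?Y"
  proof (rule bij_betw_byWitness[where f' = g])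
    show "\<forall>x\<in>?X. g (restrict x S) = x"
    proof (intro ballI ext)
      fix x t assume x: "x \<in> ?X"
      then have "x \<in> T \<rightarrow>\<^sub>E UNIV" by (simp add: degree_vectors_def)
      then show "g (restrict x S) t = x t"
        using X[OF x, of t] by (auto simp: g_def PiE_def extensional_def)
    qed
    show "\<forall>y\<in>?Y. restrict (g y) S = y"
      by (auto simp: g_def degree_vectors_def PiE_def extensional_def fun_eq_iff)
  qed (use r e in blast)+
qed

lemma sum_degree_vectors_eq:
  fixes u :: "'c::comm_semiring_1"
  assumes L: "finite L" and T: "finite T"
  shows "(\<Sum>x\<in>degree_vectors E L T. u ^ card {t \<in> T. 0 < x t})
    = (\<Sum>S\<in>Pow T. \<Sum>J | J \<in> Pow L \<and> matched E J S. u ^ card S)"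
proof -
  let ?D = "degree_vectors E L T"
  have "(\<Sum>x\<in>?D. u ^ card {t \<in> T. 0 < x t})
      = (\<Sum>S\<in>Pow T. \<Sum>x\<in>{x \<in> ?D. {t \<in> T. 0 < x t} = S}. u ^ card {t \<in> T. 0 < x t})"
    using T finite_degree_vectors[OF L T] by (intro sum.group[symmetric]) auto
  also have "\<dots> = (\<Sum>S\<in>Pow T. of_nat (card {x \<in> ?D. {t \<in> T. 0 < x t} = S}) * u ^ card S)"
    by (intro sum.cong) auto
  also have "\<dots> = (\<Sum>S\<in>Pow T. of_nat (card {J. J \<subseteq> L \<and> matched E J S}) * u ^ card S)"
  proof (intro sum.cong refl)
    fix S assume "S \<in> Pow T"
    then have "card {x \<in> ?D. {t \<in> T. 0 < x t} = S} = card {J. J \<subseteq> L \<and> matched E J S}"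
      using card_positive_degree_vectors[OF L] card_degree_vectors_support[OF L, of S T E] T
      by (auto dest: finite_subset)
    then show "of_nat (card {x \<in> ?D. {t \<in> T. 0 < x t} = S}) * u ^ card S
        = of_nat (card {J. J \<subseteq> L \<and> matched E J S}) * u ^ card S" by simp
  qed
  also have "\<dots> = (\<Sum>S\<in>Pow T. \<Sum>J | J \<in> Pow L \<and> matched E J S. u ^ card S)"
    by (intro sum.cong) auto
  finally show ?thesis .
qed

text \<open>After grouping by support, both sides sum over the perfectly matched pairs of subsets.
  Matched sets are equinumerous, so the exponent may be read off on either side.\<close>

lemma degree_vectors_duality:
  fixes u :: "'c::comm_semiring_1"
  assumes L: "finite L" and T: "finite T"
  shows "(\<Sum>x\<in>degree_vectors E L T. u ^ card {t \<in> T. 0 < x t})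
    = (\<Sum>a\<in>degree_vectors (E\<inverse>) T L. u ^ card {j \<in> L. 0 < a j})"
proof -
  have "(\<Sum>S\<in>Pow T. \<Sum>J | J \<in> Pow L \<and> matched E J S. u ^ card S)
      = (\<Sum>J\<in>Pow L. \<Sum>S | S \<in> Pow T \<and> matched E J S. u ^ card S)"
    using L T by (intro sum.swap_restrict) auto
  also have "\<dots> = (\<Sum>J\<in>Pow L. \<Sum>S | S \<in> Pow T \<and> matched (E\<inverse>) S J. u ^ card J)"
    by (intro sum.cong) (auto simp: matched_converse dest: matched_card)
  finally show ?thesis by (simp add: sum_degree_vectors_eq L T)
qed

section \<open>Weights of compositions\<close>

definition compositions :: "nat \<Rightarrow> nat \<Rightarrow> (nat \<Rightarrow> nat) set" where
  "compositions n a = {b \<in> {..<n} \<rightarrow>\<^sub>E UNIV. sum b {..<n} = a}"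

text \<open>The number of integer points of l1-norm \<open>a\<close> in dimension \<open>n\<close>,
  the power of 2 counting sign choices; equally the coefficient of z^a in ((1 + z) / (1 -
  z))^n.\<close>

definition cross_weight :: "nat \<Rightarrow> nat \<Rightarrow> nat" where
  "cross_weight n a = (\<Sum>b\<in>compositions n a. 2 ^ card {c \<in> {..<n}. 0 < b c})"

lemma finite_compositions: "finite (compositions n a)"
proof (rule finite_subset)
  show "compositions n a \<subseteq> {..<n} \<rightarrow>\<^sub>E {..a}"
  proof
    fix b assume b: "b \<in> compositions n a"
    have "b c \<le> a" if "c < n" for c
      using b member_le_sum[of c "{..<n}" b] that by (auto simp: compositions_def)
    then show "b \<in> {..<n} \<rightarrow>\<^sub>E {..a}" using b by (auto simp: compositions_def PiE_def extensional_def)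
  qed
qed (auto intro: finite_PiE)

lemma cross_weight_0: "cross_weight 0 a = of_bool (a = 0)"
  by (auto simp: cross_weight_def compositions_def)

lemma compositions_Suc:
  "bij_betw (\<lambda>(v, b). b(n := v)) (SIGMA v:{..a}. compositions n (a - v)) (compositions (Suc n) a)"
proof (rule bij_betw_byWitness[where f' = "\<lambda>b. (b n, b(n := undefined))"])
  have upd: "sum (b(n := v)) {..<n} = sum b {..<n}" for b :: "nat \<Rightarrow> nat" and v
    by (intro sum.cong) auto
  show "\<forall>x\<in>SIGMA v:{..a}. compositions n (a - v).
      ((\<lambda>(v, b). b(n := v)) x n, ((\<lambda>(v, b). b(n := v)) x)(n := undefined)) = x"
  proof
    fix x assume "x \<in> (SIGMA v:{..a}. compositions n (a - v))"
    then obtain v b where x: "x = (v, b)" "b \<in> compositions n (a - v)" by blast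
    then have "b n = undefined" by (auto simp: compositions_def PiE_def extensional_def)
    then show "((\<lambda>(v, b). b(n := v)) x n, ((\<lambda>(v, b). b(n := v)) x)(n := undefined)) = x"
      by (auto simp: x)
  qed
  show "(\<lambda>(v, b). b(n := v)) ` (SIGMA v:{..a}. compositions n (a - v)) \<subseteq> compositions (Suc n) a"
  proof (rule image_subsetI)
    fix x assume "x \<in> (SIGMA v:{..a}. compositions n (a - v))"
    then obtain v b where "x = (v, b)" "v \<le> a" "b \<in> compositions n (a - v)" by blast
    then show "(\<lambda>(v, b). b(n := v)) x \<in> compositions (Suc n) a"
      using upd[of b v] by (auto simp: compositions_def PiE_def extensional_def)
  qed
  show "(\<lambda>b. (b n, b(n := undefined))) ` compositions (Suc n) a \<subseteq> (SIGMA v:{..a}. compositions n (a - v))"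
  proof (rule image_subsetI)
    fix b assume "b \<in> compositions (Suc n) a"
    then show "(b n, b(n := undefined)) \<in> (SIGMA v:{..a}. compositions n (a - v))"
      using upd[of b undefined] by (auto simp: compositions_def PiE_def extensional_def)
  qed
qed auto

text \<open>Splitting off the last entry multiplies the generating function by (1 + z) / (1 - z) = 1
  + 2z + 2z^2 + ...: the value 0 has weight 1, every positive value weight 2.\<close>

lemma cross_weight_Suc: "cross_weight (Suc n) a = cross_weight n a + 2 * (\<Sum>b<a. cross_weight n b)"
proof -
  have "cross_weight (Suc n) a
      = (\<Sum>(v, b)\<in>(SIGMA v:{..a}. compositions n (a - v)). 2 ^ card {c \<in> {..<Suc n}. 0 < (b(n := v)) c})"
    unfolding cross_weight_def
    by (subst sum.reindex_bij_betw[OF compositions_Suc, symmetric]) (simp add: case_prod_unfold)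
  also have "\<dots> = (\<Sum>v\<in>{..a}. \<Sum>b\<in>compositions n (a - v). 2 ^ card {c \<in> {..<Suc n}. 0 < (b(n := v)) c})"
    by (subst sum.Sigma) (auto simp: finite_compositions)
  also have "\<dots> = (\<Sum>v\<in>{..a}. (if v = 0 then 1 else 2) * cross_weight n (a - v))"
  proof (intro sum.cong refl)
    fix v
    have "card {c \<in> {..<Suc n}. 0 < (b(n := v)) c} = of_bool (0 < v) + card {c \<in> {..<n}. 0 < b c}"
      for b :: "nat \<Rightarrow> nat"
    proof (cases "v = 0")
      case True
      then have "{c \<in> {..<Suc n}. 0 < (b(n := v)) c} = {c \<in> {..<n}. 0 < b c}" by auto
      with True show ?thesis by (simp only:) simp
    next
      case False
      then have "{c \<in> {..<Suc n}. 0 < (b(n := v)) c} = insert n {c \<in> {..<n}. 0 < b c}" by auto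
      with False show ?thesis by (simp only:) simp
    qed
    then show "(\<Sum>b\<in>compositions n (a - v). 2 ^ card {c \<in> {..<Suc n}. 0 < (b(n := v)) c})
        = (if v = 0 then 1 else 2) * cross_weight n (a - v)"
      by (auto simp: cross_weight_def sum_distrib_left power_add)
  qed
  also have "{..a} = insert 0 {1..a}" by auto
  also have "(\<Sum>v\<in>insert 0 {1..a}. (if v = 0 then 1 else 2) * cross_weight n (a - v))
      = cross_weight n a + 2 * (\<Sum>v\<in>{1..a}. cross_weight n (a - v))"
    by (simp add: sum_distrib_left)
  also have "(\<Sum>v\<in>{1..a}. cross_weight n (a - v)) = (\<Sum>b<a. cross_weight n b)"
    by (rule sum.reindex_bij_witness[where i = "\<lambda>b. a - b" and j = "\<lambda>v. a - v"]) auto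
  finally show ?thesis .
qed

text \<open>The coefficients of \<open>((1 + z) / (1 - z))\<^sup>x\<close> as polynomials in \<open>x\<close>; the recursion comes from
  the differential equation \<open>(1 - z\<^sup>2) F' = 2 x F\<close> of this power series.\<close>

fun cross_poly :: "nat \<Rightarrow> real poly" where
  "cross_poly 0 = 1"
| "cross_poly (Suc 0) = [:0, 2:]"
| "cross_poly (Suc (Suc a)) =
     smult (1 / real (a + 2)) ([:0, 2:] * cross_poly (Suc a) + smult (real a) (cross_poly a))"

lemma cross_poly_coeff_nonneg: "0 \<le> coeff (cross_poly a) i"
proof (induction a arbitrary: i rule: cross_poly.induct)
  case 1
  then show ?case by (simp add: coeff_1)
next
  case 2
  then show ?case by (auto simp: coeff_pCons split: nat.split)
next
  case (3 a)
  then show ?case by (auto simp: coeff_pCons split: nat.split)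
qed

lemma cross_poly_coeff_self: "0 < coeff (cross_poly a) a"
proof (induction a rule: cross_poly.induct)
  case (3 a)
  have "0 < 2 * coeff (cross_poly (Suc a)) (Suc a) + real a * coeff (cross_poly a) (Suc (Suc a))"
    using 3 cross_poly_coeff_nonneg[of a "Suc (Suc a)"] by (intro add_pos_nonneg) auto
  then show ?case by simp
qed auto

lemma cross_poly_degree: "degree (cross_poly a) \<le> a"
proof (induction a rule: cross_poly.induct)
  case (3 a)
  have "degree ([:0, 2:] * cross_poly (Suc a)) \<le> Suc (Suc a)"
    using degree_mult_le[of "[:0, 2:]" "cross_poly (Suc a)"] 3(1) by simp
  moreover have "degree (smult (real a) (cross_poly a)) \<le> Suc (Suc a)"
    using degree_smult_le[of "real a" "cross_poly a"] 3(2) by linarith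
  ultimately have "degree ([:0, 2:] * cross_poly (Suc a) + smult (real a) (cross_poly a)) \<le> Suc (Suc a)"
    by (rule degree_add_le)
  then show ?case
    unfolding cross_poly.simps by (rule order_trans[OF degree_smult_le])
qed auto

lemma cross_poly_at_0: "poly (cross_poly a) 0 = of_bool (a = 0)"
  by (induction a rule: cross_poly.induct) (auto simp: zero_compare_simps)

lemma cross_poly_rec:
  "real (a + 2) * poly (cross_poly (Suc (Suc a))) x
     = 2 * x * poly (cross_poly (Suc a)) x + real a * poly (cross_poly a) x"
  by (simp del: of_nat_add of_nat_Suc)

text \<open>With F_x the power series ((1 + z) / (1 - z))^x, this compares coefficients in (1 - z)
  F_{x+1} = (1 + z) F_x.\<close>

lemma cross_poly_diff:
  "poly (cross_poly (Suc a)) (x + 1) - poly (cross_poly (Suc a)) x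
     = poly (cross_poly a) (x + 1) + poly (cross_poly a) x"
proof (induction a rule: cross_poly.induct)
  case 1
  then show ?case by simp
next
  case 2
  show ?case using cross_poly_rec[of 0 x] cross_poly_rec[of 0 "x + 1"]
    by (simp del: cross_poly.simps(3) add: algebra_simps)
next
  case (3 a)
  define g h where "g b = poly (cross_poly b) x" and "h b = poly (cross_poly b) (x + 1)" for b
  have r: "real (b + 2) * g (b + 2) = 2 * x * g (b + 1) + real b * g b"
    "real (b + 2) * h (b + 2) = 2 * (x + 1) * h (b + 1) + real b * h b" for b
    using cross_poly_rec[of b x] cross_poly_rec[of b "x + 1"] by (simp_all add: g_def h_def)
  have IH: "h (a + 2) - g (a + 2) = h (a + 1) + g (a + 1)" "h (a + 1) - g (a + 1) = h a + g a"
    using 3 by (simp_all add: g_def h_def)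
  \<comment> \<open>The recursion is applied at \<open>x\<close> and at \<open>x + 1\<close>; the
    two induction hypotheses remove the terms in which \<open>x\<close> occurs as a factor.\<close>
  have "real (a + 3) * (h (a + 3) - g (a + 3))
      = 2 * (x + 1) * h (a + 2) - 2 * x * g (a + 2) + real (a + 1) * (h (a + 1) - g (a + 1))"
    using r[of "a + 1"] by (simp add: algebra_simps numeral_eq_Suc)
  also have "\<dots> = 2 * x * (h (a + 2) - g (a + 2)) + 2 * h (a + 2) + real (a + 1) * (h a + g a)"
    using IH by (simp add: algebra_simps)
  also have "\<dots> = 2 * (x + 1) * h (a + 1) + 2 * x * g (a + 1) - 2 * h (a + 1) + 2 * h (a + 2)
      + real (a + 1) * (h a + g a)"
    unfolding IH by (simp add: algebra_simps)
  also have "\<dots> = real (a + 2) * h (a + 2) - real a * h a + real (a + 2) * g (a + 2) - real a * g a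
      - 2 * h (a + 1) + 2 * h (a + 2) + real (a + 1) * (h a + g a)"
    using r[of a] by linarith
  also have "\<dots> = real (a + 3) * (h (a + 2) + g (a + 2))"
  proof -
    have "h a = h (a + 1) - g (a + 1) - g a" "h (a + 1) = h (a + 2) - g (a + 2) - g (a + 1)"
      using IH by simp_all
    then show ?thesis by (simp add: algebra_simps)
  qed
  finally have "h (a + 3) - g (a + 3) = h (a + 2) + g (a + 2)" by simp
  then show ?case by (simp add: g_def h_def numeral_eq_Suc)
qed

lemma cross_poly_Suc_sum:
  "poly (cross_poly a) (x + 1) = poly (cross_poly a) x + 2 * (\<Sum>b<a. poly (cross_poly b) x)"
proof (induction a)
  case (Suc a)
  then show ?case using cross_poly_diff[of a x] by simp
qed simp

text \<open>Both sides have the same values at \<open>n = 0\<close> and satisfy the same recursion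
  in \<open>n\<close>.\<close>

lemma poly_cross_poly: "poly (cross_poly a) (real n) = real (cross_weight n a)"
proof (induction n arbitrary: a)
  case 0
  then show ?case by (simp add: cross_poly_at_0 cross_weight_0)
next
  case (Suc n)
  then show ?case using cross_poly_Suc_sum[of a "real n"] by (simp add: cross_weight_Suc add.commute)
qed

section \<open>Left vertices with capacities\<close>

text \<open>Cloning turns a left vertex of capacity \<open>k j\<close> into \<open>k j\<close>
  vertices with the same neighbours, each to be used at most once.\<close>

definition copies :: "'l set \<Rightarrow> ('l \<Rightarrow> nat) \<Rightarrow> ('l \<times> nat) set" where
  "copies M k = (SIGMA j:M. {..<k j})"

definition copied_edges :: "('l \<times> 'r) set \<Rightarrow> (('l \<times> nat) \<times> 'r) set" where
  "copied_edges E = {(p, i). (fst p, i) \<in> E}"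

lemma finite_copies: "finite M \<Longrightarrow> finite (copies M k)"
  by (simp add: copies_def)

text \<open>Here each right vertex chooses at most one copy. Forgetting the index of the copy adds
  up the degrees; conversely, the right vertices that chose \<open>j\<close> can be distributed over
  its copies in any prescribed numbers, as all copies have the same neighbours.\<close>

lemma degree_vectors_copies:
  assumes M: "finite M" and R: "finite R" and x: "x \<in> copies M k \<rightarrow>\<^sub>E UNIV"
  shows "x \<in> degree_vectors ((copied_edges E)\<inverse>) R (copies M k) \<longleftrightarrow>
    (\<lambda>j\<in>M. \<Sum>c<k j. x (j, c)) \<in> degree_vectors (E\<inverse>) R M"
proof
  assume "x \<in> degree_vectors ((copied_edges E)\<inverse>) R (copies M k)"
  then obtain \<sigma> where \<sigma>: "\<And>i p. i \<in> R \<Longrightarrow> \<sigma> i = Some p \<Longrightarrow> p \<in> copies M k \<and> (fst p, i) \<in> E"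
      "\<And>p. p \<in> copies M k \<Longrightarrow> card {i \<in> R. \<sigma> i = Some p} = x p"
    unfolding degree_vectors_def copied_edges_def by blast
  have "card {i \<in> R. map_option fst (\<sigma> i) = Some j} = (\<Sum>c<k j. x (j, c))" if j: "j \<in> M" for j
  proof -
    have "{i \<in> R. map_option fst (\<sigma> i) = Some j} = (\<Union>c<k j. {i \<in> R. \<sigma> i = Some (j, c)})"
      using \<sigma>(1) by (fastforce simp: copies_def)
    also have "card \<dots> = (\<Sum>c<k j. card {i \<in> R. \<sigma> i = Some (j, c)})"
      using R by (intro card_UN_disjoint) auto
    also have "\<dots> = (\<Sum>c<k j. x (j, c))"
      using \<sigma>(2) j by (intro sum.cong) (auto simp: copies_def)
    finally show ?thesis .
  qed
  moreover have "j \<in> M \<and> (j, i) \<in> E" if "i \<in> R" "map_option fst (\<sigma> i) = Some j" for i j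
    using \<sigma>(1)[OF that(1)] that(2) by (auto simp: copies_def)
  ultimately show "(\<lambda>j\<in>M. \<Sum>c<k j. x (j, c)) \<in> degree_vectors (E\<inverse>) R M"
    unfolding degree_vectors_def by (auto intro!: exI[of _ "\<lambda>i. map_option fst (\<sigma> i)"])
next
  assume "(\<lambda>j\<in>M. \<Sum>c<k j. x (j, c)) \<in> degree_vectors (E\<inverse>) R M"
  then obtain \<sigma> where \<sigma>: "\<And>i j. i \<in> R \<Longrightarrow> \<sigma> i = Some j \<Longrightarrow> j \<in> M \<and> (j, i) \<in> E"
      "\<And>j. j \<in> M \<Longrightarrow> card {i \<in> R. \<sigma> i = Some j} = (\<Sum>c<k j. x (j, c))"
    unfolding degree_vectors_def by auto
  \<comment> \<open>The first component of \<open>f j i\<close> will be the copy of \<open>j\<close>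
    given to \<open>i\<close>; the second only numbers the right vertices sharing that copy.\<close>
  have "\<exists>f. bij_betw f {i \<in> R. \<sigma> i = Some j} (SIGMA c:{..<k j}. {..<x (j, c)})" if "j \<in> M" for j
    using \<sigma>(2)[OF that] R by (intro finite_same_card_bij) auto
  then obtain f where f: "\<And>j. j \<in> M \<Longrightarrow>
      bij_betw (f j) {i \<in> R. \<sigma> i = Some j} (SIGMA c:{..<k j}. {..<x (j, c)})" by metis
  define \<tau> where "\<tau> i = (case \<sigma> i of None \<Rightarrow> None | Some j \<Rightarrow> Some (j, fst (f j i)))" for i
  have \<tau>_iff: "\<tau> i = Some (j, c) \<longleftrightarrow> \<sigma> i = Some j \<and> fst (f j i) = c" for i j c
    by (auto simp: \<tau>_def split: option.splits)
  have "p \<in> copies M k \<and> (fst p, i) \<in> E" if i: "i \<in> R" and p: "\<tau> i = Some p" for i p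
  proof (cases p)
    case (Pair j c)
    then have s: "\<sigma> i = Some j" "fst (f j i) = c" using p \<tau>_iff by auto
    then have j: "j \<in> M" "(j, i) \<in> E" using \<sigma>(1) i by auto
    then have "f j i \<in> (SIGMA c:{..<k j}. {..<x (j, c)})" using bij_betwE[OF f] i s by blast
    then show ?thesis using s j Pair by (auto simp: copies_def)
  qed
  moreover have "card {i \<in> R. \<tau> i = Some p} = x p" if p: "p \<in> copies M k" for p
  proof (cases p)
    case (Pair j c)
    then have j: "j \<in> M" "c < k j" using p by (auto simp: copies_def)
    have "bij_betw (f j) {i \<in> R. \<tau> i = Some p} ({c} \<times> {..<x (j, c)})"
    proof (rule bij_betw_imageI)
      show "inj_on (f j) {i \<in> R. \<tau> i = Some p}"
        using bij_betw_imp_inj_on[OF f[OF j(1)]] by (rule inj_on_subset) (auto simp: Pair \<tau>_iff)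
      have "f j ` {i \<in> R. \<sigma> i = Some j} = (SIGMA c:{..<k j}. {..<x (j, c)})"
        using f[OF j(1)] by (simp add: bij_betw_def)
      then have im: "f j ` {i \<in> R. \<sigma> i = Some j} \<inter> {y. fst y = c} = {c} \<times> {..<x (j, c)}"
        using j by auto
      have "{i \<in> R. \<tau> i = Some p} = {i \<in> R. \<sigma> i = Some j} \<inter> {i. fst (f j i) = c}"
        unfolding Pair \<tau>_iff by blast
      then have "f j ` {i \<in> R. \<tau> i = Some p} = f j ` {i \<in> R. \<sigma> i = Some j} \<inter> {y. fst y = c}"
        by blast
      then show "f j ` {i \<in> R. \<tau> i = Some p} = {c} \<times> {..<x (j, c)}"
        using im by simp
    qed
    then show ?thesis by (auto simp: Pair dest: bij_betw_same_card)
  qed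
  ultimately show "x \<in> degree_vectors ((copied_edges E)\<inverse>) R (copies M k)"
    using x unfolding degree_vectors_def copied_edges_def by (auto intro!: exI[of _ \<tau>])
qed

text \<open>By currying, \<open>x\<close> is a family of compositions, one for each
  \<open>j\<close>. Its support is the disjoint union of theirs, so the powers of 2
  multiply.\<close>

lemma sum_fibre_copies:
  fixes M :: "'l set" and a :: "'l \<Rightarrow> nat"
  assumes M: "finite M"
  shows "(\<Sum>x | x \<in> copies M k \<rightarrow>\<^sub>E UNIV \<and> (\<forall>j\<in>M. (\<Sum>c<k j. x (j, c)) = a j).
      2 ^ card {p \<in> copies M k. 0 < x p}) = (\<Prod>j\<in>M. cross_weight (k j) (a j))"
proof -
  let ?F = "\<lambda>x::'l \<times> nat \<Rightarrow> nat. \<lambda>j\<in>M. \<lambda>c\<in>{..<k j}. x (j, c)"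
  let ?G = "\<lambda>b. \<lambda>p\<in>copies M k. b (fst p) (snd p)"
  let ?A = "{x \<in> copies M k \<rightarrow>\<^sub>E UNIV. \<forall>j\<in>M. (\<Sum>c<k j. x (j, c)) = a j}"
  let ?B = "\<Pi>\<^sub>E j\<in>M. compositions (k j) (a j)"
  have bij: "bij_betw ?G ?B ?A"
  proof (rule bij_betw_byWitness[where f' = ?F])
    show "\<forall>b\<in>?B. ?F (?G b) = b"
    proof (intro ballI ext)
      fix b j c assume b: "b \<in> ?B"
      show "?F (?G b) j c = b j c"
      proof (cases "j \<in> M")
        case True
        then have "b j \<in> {..<k j} \<rightarrow>\<^sub>E UNIV" using b by (auto simp: compositions_def)
        then show ?thesis using True by (auto simp: copies_def PiE_def extensional_def)
      next
        case False
        then show ?thesis using b by (auto simp: PiE_def extensional_def)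
      qed
    qed
    show "\<forall>x\<in>?A. ?G (?F x) = x"
      by (auto simp: copies_def PiE_def extensional_def fun_eq_iff)
    show "?G ` ?B \<subseteq> ?A"
    proof (rule image_subsetI)
      fix b assume b: "b \<in> ?B"
      have "(\<Sum>c<k j. ?G b (j, c)) = a j" if "j \<in> M" for j
      proof -
        have "(\<Sum>c<k j. ?G b (j, c)) = (\<Sum>c<k j. b j c)"
          using that by (intro sum.cong) (auto simp: copies_def)
        also have "\<dots> = a j" using b that by (auto simp: compositions_def)
        finally show ?thesis .
      qed
      then show "?G b \<in> ?A" by auto
    qed
    show "?F ` ?A \<subseteq> ?B"
    proof (rule image_subsetI)
      fix x assume x: "x \<in> ?A"
      have "(\<lambda>c\<in>{..<k j}. x (j, c)) \<in> compositions (k j) (a j)" if "j \<in> M" for j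
        using x that by (simp add: compositions_def restrict_PiE_iff)
      then show "?F x \<in> ?B" by simp
    qed
  qed
  have "(\<Sum>x | x \<in> copies M k \<rightarrow>\<^sub>E UNIV \<and> (\<forall>j\<in>M. (\<Sum>c<k j. x (j, c)) = a j).
      2 ^ card {p \<in> copies M k. 0 < x p})
      = (\<Sum>b\<in>?B. 2 ^ card {p \<in> copies M k. 0 < ?G b p} :: nat)"
    by (rule sum.reindex_bij_betw[OF bij, symmetric])
  also have "\<dots> = (\<Sum>b\<in>?B. \<Prod>j\<in>M. 2 ^ card {c \<in> {..<k j}. 0 < b j c})"
  proof (intro sum.cong refl)
    fix b
    have "{p \<in> copies M k. 0 < ?G b p} = (SIGMA j:M. {c \<in> {..<k j}. 0 < b j c})"
      by (auto simp: copies_def)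
    then show "2 ^ card {p \<in> copies M k. 0 < ?G b p} = (\<Prod>j\<in>M. 2 ^ card {c \<in> {..<k j}. 0 < b j c} :: nat)"
      using M by (simp add: power_sum)
  qed
  also have "\<dots> = (\<Prod>j\<in>M. cross_weight (k j) (a j))"
    unfolding cross_weight_def using M finite_compositions by (subst prod_sum_PiE) auto
  finally show ?thesis .
qed

text \<open>Duality moves the sum to the side of the copies. There, by
  \<open>degree_vectors_copies\<close>, membership depends only on the total degree at each original
  left vertex, so each fibre is summed by \<open>sum_fibre_copies\<close>.\<close>

lemma sum_degree_vectors_copies:
  assumes M: "finite M" and R: "finite R"
  shows "(\<Sum>x\<in>degree_vectors (copied_edges E) (copies M k) R. 2 ^ card {i \<in> R. 0 < x i})
    = (\<Sum>a\<in>degree_vectors (E\<inverse>) R M. \<Prod>j\<in>M. cross_weight (k j) (a j))"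
proof -
  let ?D = "degree_vectors ((copied_edges E)\<inverse>) R (copies M k)"
  let ?s = "\<lambda>x. \<lambda>j\<in>M. \<Sum>c<k j. x (j, c)"
  have PiE: "x \<in> copies M k \<rightarrow>\<^sub>E UNIV" if "x \<in> ?D" for x
    using that by (simp add: degree_vectors_def)
  have "(\<Sum>x\<in>degree_vectors (copied_edges E) (copies M k) R. 2 ^ card {i \<in> R. 0 < x i})
      = (\<Sum>x\<in>?D. 2 ^ card {p \<in> copies M k. 0 < x p} :: nat)"
    by (rule degree_vectors_duality[OF finite_copies[OF M] R])
  also have "\<dots> = (\<Sum>a\<in>degree_vectors (E\<inverse>) R M. \<Sum>x\<in>{x \<in> ?D. ?s x = a}. 2 ^ card {p \<in> copies M k. 0 < x p})"
    using degree_vectors_copies[OF M R PiE]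
    by (intro sum.group[symmetric] finite_degree_vectors R M finite_copies image_subsetI) blast
  also have "\<dots> = (\<Sum>a\<in>degree_vectors (E\<inverse>) R M. \<Prod>j\<in>M. cross_weight (k j) (a j))"
  proof (intro sum.cong refl)
    fix a assume a: "a \<in> degree_vectors (E\<inverse>) R M"
    then have "a \<in> M \<rightarrow>\<^sub>E UNIV" by (simp add: degree_vectors_def)
    then have eq: "?s x = a \<longleftrightarrow> (\<forall>j\<in>M. (\<Sum>c<k j. x (j, c)) = a j)" for x
      by (auto simp: fun_eq_iff PiE_def extensional_def)
    have "{x \<in> ?D. ?s x = a} = {x. x \<in> copies M k \<rightarrow>\<^sub>E UNIV \<and> ?s x = a}"
      using PiE degree_vectors_copies[OF M R] a by blast
    then show "(\<Sum>x\<in>{x \<in> ?D. ?s x = a}. 2 ^ card {p \<in> copies M k. 0 < x p})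
        = (\<Prod>j\<in>M. cross_weight (k j) (a j))"
      unfolding eq using sum_fibre_copies[OF M] by simp
  qed
  finally show ?thesis .
qed

section \<open>Hall's theorem\<close>

text \<open>The Halmos-Vaughan argument: if a nonempty proper subset has exactly as many neighbours
  as elements, match it and its complement separately; otherwise match one element arbitrarily and
  remove its partner.\<close>

lemma hall_marriage:
  assumes "finite A" "\<And>a. a \<in> A \<Longrightarrow> finite (N a)"
    "\<And>S. S \<subseteq> A \<Longrightarrow> card S \<le> card (\<Union>(N ` S))"
  shows "\<exists>f. inj_on f A \<and> (\<forall>a\<in>A. f a \<in> N a)"
  using assms
proof (induction "card A" arbitrary: A N rule: less_induct)
  case less
  show ?case
  proof (cases "\<exists>S. S \<subset> A \<and> S \<noteq> {} \<and> card S = card (\<Union>(N ` S))")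
    case True
    then obtain S where S: "S \<subset> A" "S \<noteq> {}" "card S = card (\<Union>(N ` S))" by blast
    have finS: "finite S" using S less.prems(1) by (meson finite_subset psubset_imp_subset)
    have finN: "finite (\<Union>(N ` S))" using finS S less.prems(2) by blast
    have "\<exists>f. inj_on f S \<and> (\<forall>a\<in>S. f a \<in> N a)"
    proof (rule less.hyps)
      show "card S < card A" by (rule psubset_card_mono[OF less.prems(1) S(1)])
    qed (use S finS less.prems in blast)+
    then obtain f where f: "inj_on f S" "\<forall>a\<in>S. f a \<in> N a" by blast
    have "\<exists>g. inj_on g (A - S) \<and> (\<forall>a\<in>A - S. g a \<in> N a - \<Union>(N ` S))"
    proof (rule less.hyps)
      show "card (A - S) < card A" using S less.prems(1)
        by (intro psubset_card_mono) auto
      fix U assume U: "U \<subseteq> A - S"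
      have finU: "finite U" using U less.prems(1) by (meson finite_Diff finite_subset)
      \<comment> \<open>Hall's condition for \<open>U \<union> S\<close> minus the equality for
        \<open>S\<close> leaves Hall's condition for \<open>U\<close> with the neighbours of
        \<open>S\<close> deleted.\<close>
      have "card U + card S = card (U \<union> S)" using U finU finS by (subst card_Un_disjoint) auto
      also have "\<dots> \<le> card (\<Union>(N ` (U \<union> S)))" using less.prems(3)[of "U \<union> S"] U S by blast
      also have "\<Union>(N ` (U \<union> S)) = \<Union>((\<lambda>a. N a - \<Union>(N ` S)) ` U) \<union> \<Union>(N ` S)" by blast
      also have "card \<dots> \<le> card (\<Union>((\<lambda>a. N a - \<Union>(N ` S)) ` U)) + card (\<Union>(N ` S))"
        by (rule card_Un_le)
      finally show "card U \<le> card (\<Union>((\<lambda>a. N a - \<Union>(N ` S)) ` U))" using S(3) by simp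
    qed (use less.prems in auto)
    then obtain g where g: "inj_on g (A - S)" "\<forall>a\<in>A - S. g a \<in> N a - \<Union>(N ` S)" by blast
    have "inj_on (\<lambda>a. if a \<in> S then f a else g a) A"
    proof (rule inj_onI)
      fix a b assume ab: "a \<in> A" "b \<in> A" "(if a \<in> S then f a else g a) = (if b \<in> S then f b else g b)"
      show "a = b"
      proof (cases "a \<in> S"; cases "b \<in> S")
        assume "a \<in> S" "b \<in> S"
        then show ?thesis using ab f by (simp add: inj_on_def)
      next
        assume "a \<in> S" "b \<notin> S"
        then show ?thesis using ab f g by (metis DiffD2 DiffI UN_I)
      next
        assume "a \<notin> S" "b \<in> S"
        then show ?thesis using ab f g by (metis DiffD2 DiffI UN_I)
      next
        assume "a \<notin> S" "b \<notin> S"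
        then show ?thesis using ab g by (simp add: inj_on_def)
      qed
    qed
    moreover have "\<forall>a\<in>A. (if a \<in> S then f a else g a) \<in> N a" using f g by auto
    ultimately show ?thesis by blast
  next
    case False
    show ?thesis
    proof (cases "A = {}")
      case nonempty: False
      then obtain a where a: "a \<in> A" by blast
      have "card {a} \<le> card (\<Union>(N ` {a}))" using less.prems(3)[of "{a}"] a by blast
      then obtain y where y: "y \<in> N a" by fastforce
      have "\<exists>g. inj_on g (A - {a}) \<and> (\<forall>b\<in>A - {a}. g b \<in> N b - {y})"
      proof (rule less.hyps)
        show "card (A - {a}) < card A" using a less.prems(1) by (intro psubset_card_mono) auto
        fix U assume U: "U \<subseteq> A - {a}"
        have eq: "\<Union>((\<lambda>b. N b - {y}) ` U) = \<Union>(N ` U) - {y}" by blast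
        have finN: "finite (\<Union>(N ` U))" using U less.prems(1,2)
          by (meson DiffD1 finite_Diff finite_UN_I finite_subset subsetD)
        show "card U \<le> card (\<Union>((\<lambda>b. N b - {y}) ` U))"
        proof (cases "U = {}")
          case nonempty: False
          have "U \<subset> A" using U a by blast
          \<comment> \<open>Without a critical subset the inequality for \<open>U\<close> is strict,
            and this surplus pays for the loss of \<open>y\<close>.\<close>
          then have "card U \<noteq> card (\<Union>(N ` U))" using False nonempty by blast
          moreover have "card U \<le> card (\<Union>(N ` U))" using less.prems(3)[of U] U by blast
          ultimately have "card U \<le> card (\<Union>(N ` U)) - 1" by simp
          also have "\<dots> \<le> card (\<Union>(N ` U) - {y})"
            using diff_card_le_card_Diff[of "{y}" "\<Union>(N ` U)"] by simp
          finally show ?thesis by (simp add: eq)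
        qed simp
      qed (use less.prems in auto)
      then obtain g where g: "inj_on g (A - {a})" "\<forall>b\<in>A - {a}. g b \<in> N b - {y}" by blast
      have "inj_on (g(a := y)) A"
        using g by (auto simp: inj_on_def)
      moreover have "\<forall>b\<in>A. (g(a := y)) b \<in> N b" using g y by auto
      ultimately show ?thesis by blast
    qed simp
  qed
qed

text \<open>Hall's theorem with \<open>x t\<close> clones of each \<open>t\<close>, matched into
  \<open>L\<close>; inverting the matching gives the assignment of left vertices. Taking all clones
  of the vertices involved is the worst case of Hall's condition.\<close>

lemma hall_degree_vectors:
  assumes L: "finite L" and T: "finite T" and x: "x \<in> T \<rightarrow>\<^sub>E UNIV"
    and le: "\<And>S. S \<subseteq> T \<Longrightarrow> sum x S \<le> card {j \<in> L. \<exists>t\<in>S. (j, t) \<in> E}"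
  shows "x \<in> degree_vectors E L T"
proof -
  define A where "A = (SIGMA t:T. {..<x t})"
  have "\<exists>f. inj_on f A \<and> (\<forall>a\<in>A. f a \<in> {j \<in> L. (j, fst a) \<in> E})"
  proof (rule hall_marriage)
    show "finite A" using T by (auto simp: A_def)
    fix U assume U: "U \<subseteq> A"
    have fin: "finite (fst ` U)" using U \<open>finite A\<close> finite_subset by blast
    have sub: "fst ` U \<subseteq> T" using U by (auto simp: A_def)
    have "card U \<le> card (SIGMA t:fst ` U. {..<x t})"
      using U fin by (intro card_mono) (auto simp: A_def image_iff intro!: finite_SigmaI, force)
    also have "\<dots> = sum x (fst ` U)" using fin by simp
    also have "\<dots> \<le> card {j \<in> L. \<exists>t\<in>fst ` U. (j, t) \<in> E}" by (rule le[OF sub])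
    also have "{j \<in> L. \<exists>t\<in>fst ` U. (j, t) \<in> E} = (\<Union>a\<in>U. {j \<in> L. (j, fst a) \<in> E})" by auto
    finally show "card U \<le> card (\<Union>a\<in>U. {j \<in> L. (j, fst a) \<in> E})" .
  qed (use L in auto)
  then obtain f where f: "inj_on f A" "\<And>a. a \<in> A \<Longrightarrow> f a \<in> L \<and> (f a, fst a) \<in> E" by blast
  define \<sigma> where "\<sigma> j = (if j \<in> f ` A then Some (fst (inv_into A f j)) else None)" for j
  have \<sigma>f: "\<sigma> (f a) = Some (fst a)" if "a \<in> A" for a using that f(1) by (simp add: \<sigma>_def)
  have \<sigma>_iff: "\<sigma> j = Some t \<longleftrightarrow> (\<exists>a\<in>A. j = f a \<and> fst a = t)" for j t
  proof
    assume "\<sigma> j = Some t"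
    then have "j \<in> f ` A" by (auto simp: \<sigma>_def split: if_splits)
    then obtain a where "a \<in> A" "j = f a" by blast
    then show "\<exists>a\<in>A. j = f a \<and> fst a = t" using \<sigma>f \<open>\<sigma> j = Some t\<close> by auto
  qed (use \<sigma>f in auto)
  have "card {j \<in> L. \<sigma> j = Some t} = x t" if "t \<in> T" for t
  proof -
    have "{j \<in> L. \<sigma> j = Some t} = f ` ({t} \<times> {..<x t})"
      using that f(2) by (force simp: \<sigma>_iff A_def)
    moreover have "inj_on f ({t} \<times> {..<x t})"
      using f(1) that by (auto simp: A_def intro: inj_on_subset)
    ultimately show ?thesis by (simp add: card_image)
  qed
  moreover have "t \<in> T \<and> (j, t) \<in> E" if "\<sigma> j = Some t" for j t
    using that f(2) by (auto simp: \<sigma>_iff A_def)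
  ultimately show ?thesis using x by (auto simp: degree_vectors_def)
qed

section \<open>Lattice points and dimension\<close>

definition l1_ball :: "real \<Rightarrow> 'n set \<Rightarrow> (real ^ 'n::finite) set" where
  "l1_ball r I = {y. (\<forall>i. i \<notin> I \<longrightarrow> y $ i = 0) \<and> (\<Sum>i\<in>UNIV. \<bar>y $ i\<bar>) \<le> r}"

lemma convex_l1_ball:
  fixes I :: "'n::finite set"
  shows "convex (l1_ball r I)"
proof (rule convexI)
  fix x y :: "real ^ 'n" and u v :: real
  assume *: "x \<in> l1_ball r I" "y \<in> l1_ball r I" "0 \<le> u" "0 \<le> v" "u + v = 1"
  have "(\<Sum>i\<in>UNIV. \<bar>(u *\<^sub>R x + v *\<^sub>R y) $ i\<bar>) \<le> (\<Sum>i\<in>UNIV. u * \<bar>x $ i\<bar> + v * \<bar>y $ i\<bar>)"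
    using * by (intro sum_mono) (auto intro: order_trans[OF abs_triangle_ineq] simp: abs_mult)
  also have "\<dots> = u * (\<Sum>i\<in>UNIV. \<bar>x $ i\<bar>) + v * (\<Sum>i\<in>UNIV. \<bar>y $ i\<bar>)"
    by (simp add: sum.distrib sum_distrib_left)
  also have "\<dots> \<le> u * r + v * r"
    using * by (intro add_mono mult_left_mono) (auto simp: l1_ball_def)
  also have "\<dots> = r" using * by (simp add: distrib_right[symmetric])
  finally show "u *\<^sub>R x + v *\<^sub>R y \<in> l1_ball r I" using * by (auto simp: l1_ball_def)
qed

lemma l1_norm_axis: "(\<Sum>i\<in>UNIV. \<bar>axis j c $ i\<bar>) = \<bar>c :: real\<bar>"
proof -
  have "(\<Sum>i\<in>UNIV. \<bar>axis j c $ i\<bar>) = (\<Sum>i\<in>UNIV. if i = j then \<bar>c\<bar> else 0)"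
    by (intro sum.cong) (auto simp: axis_def)
  then show ?thesis by simp
qed

lemma axis_in_cross_polytope:
  assumes "i \<in> I" "\<bar>c\<bar> = 1"
  shows "axis i c \<in> cross_polytope I"
proof -
  have "c = 1 \<or> c = - 1" using assms by linarith
  then have "axis i c = axis i 1 \<or> axis i c = - axis i 1" by (auto simp: vec_eq_iff axis_def)
  then have "axis i c \<in> (\<lambda>i. axis i 1) ` I \<union> (\<lambda>i. - axis i 1) ` I" using assms(1) by blast
  then show ?thesis using assms unfolding cross_polytope_def by (auto intro: hull_inc)
qed

lemma zero_in_cross_polytope: "0 \<in> cross_polytope I"
proof (cases "I = {}")
  case False
  then obtain i where i: "i \<in> I" by blast
  have "convex (cross_polytope I)" by (simp add: cross_polytope_def)
  then have "(1 / 2) *\<^sub>R axis i 1 + (1 / 2) *\<^sub>R axis i (-1) \<in> cross_polytope I"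
    using axis_in_cross_polytope[OF i] by (intro convexD) auto
  also have "(1 / 2) *\<^sub>R axis i 1 + (1 / 2) *\<^sub>R axis i (-1) = (0 :: real ^ 'a)"
    by (simp add: vec_eq_iff axis_def)
  finally show ?thesis .
qed (simp add: cross_polytope_def)

text \<open>A nonzero point with l1-norm \<open>s \<le> 1\<close> is \<open>s\<close> times a convex
  combination of signed unit vectors, the remaining weight \<open>1 - s\<close> being put on the
  origin.\<close>

lemma cross_polytope_eq_l1_ball: "cross_polytope I = l1_ball 1 I"
proof
  show "cross_polytope I \<subseteq> l1_ball 1 I"
  proof (cases "I = {}")
    case False
    have "convex hull ((\<lambda>i. axis i 1) ` I \<union> (\<lambda>i. - axis i 1) ` I) \<subseteq> l1_ball 1 I"
    proof (rule hull_minimal)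
      have "axis i 1 \<in> l1_ball 1 I" "- axis i 1 \<in> l1_ball 1 I" if "i \<in> I" for i
        using that l1_norm_axis[of i 1] by (auto simp: l1_ball_def axis_def)
      then show "(\<lambda>i. axis i 1) ` I \<union> (\<lambda>i. - axis i 1) ` I \<subseteq> l1_ball 1 I" by blast
    qed (rule convex_l1_ball)
    then show ?thesis using False by (simp add: cross_polytope_def)
  qed (simp add: cross_polytope_def l1_ball_def)
  show "l1_ball 1 I \<subseteq> cross_polytope I"
  proof
    fix y assume y: "y \<in> l1_ball 1 I"
    define s where "s = (\<Sum>i\<in>UNIV. \<bar>y $ i\<bar>)"
    have s: "0 \<le> s" "s \<le> 1" using y by (auto simp: s_def l1_ball_def intro: sum_nonneg)
    have s_I: "s = (\<Sum>i\<in>I. \<bar>y $ i\<bar>)"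
      unfolding s_def using y by (intro sum.mono_neutral_right) (auto simp: l1_ball_def)
    show "y \<in> cross_polytope I"
    proof (cases "s = 0")
      case True
      then have "\<forall>i. \<bar>y $ i\<bar> = 0" unfolding s_def by (subst (asm) sum_nonneg_eq_0_iff) auto
      then have "y = 0" by (simp add: vec_eq_iff)
      then show ?thesis by (simp add: zero_in_cross_polytope)
    next
      case False
      have conv: "convex (cross_polytope I)" by (simp add: cross_polytope_def)
      have "(\<Sum>i\<in>I. (\<bar>y $ i\<bar> / s) *\<^sub>R axis i (if y $ i < 0 then -1 else 1)) \<in> cross_polytope I"
      proof (rule convex_sum[OF _ conv])
        show "(\<Sum>i\<in>I. \<bar>y $ i\<bar> / s) = 1"
          using False s_I by (simp add: sum_divide_distrib[symmetric])
      qed (use s in \<open>auto intro!: axis_in_cross_polytope\<close>)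
      then have "s *\<^sub>R (\<Sum>i\<in>I. (\<bar>y $ i\<bar> / s) *\<^sub>R axis i (if y $ i < 0 then -1 else 1))
          + (1 - s) *\<^sub>R 0 \<in> cross_polytope I"
        using s zero_in_cross_polytope by (intro convexD[OF conv]) auto
      also have "s *\<^sub>R (\<Sum>i\<in>I. (\<bar>y $ i\<bar> / s) *\<^sub>R axis i (if y $ i < 0 then -1 else 1)) + (1 - s) *\<^sub>R 0
          = (\<Sum>i\<in>I. axis i (y $ i))"
      proof -
        have "s *\<^sub>R ((\<bar>y $ i\<bar> / s) *\<^sub>R axis i (if y $ i < 0 then -1 else 1)) = axis i (y $ i)" for i
          using False by (auto simp: vec_eq_iff axis_def)
        then show ?thesis by (simp only: scaleR_sum_right scaleR_zero_right add_0_right)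
      qed
      also have "\<dots> = y"
      proof (rule vec_eq_iff[THEN iffD2], rule allI)
        fix l
        have "(\<Sum>i\<in>I. axis i (y $ i)) $ l = (\<Sum>i\<in>I. if i = l then y $ l else 0)"
          unfolding sum_component by (intro sum.cong) (auto simp: axis_def)
        then show "(\<Sum>i\<in>I. axis i (y $ i)) $ l = y $ l"
          using y by (simp add: l1_ball_def)
      qed
      finally show ?thesis .
    qed
  qed
qed

lemma scaled_cross_polytope:
  assumes "0 \<le> r"
  shows "(*\<^sub>R) r ` cross_polytope I = l1_ball r I"
proof (cases "r = 0")
  case True
  have "l1_ball 0 I = {0}"
  proof -
    have "y = 0" if "(\<Sum>i\<in>UNIV. \<bar>y $ i\<bar>) \<le> 0" for y :: "real ^ 'a"
    proof -
      have "(\<Sum>i\<in>UNIV. \<bar>y $ i\<bar>) = 0" using that by (intro antisym sum_nonneg) auto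
      then show ?thesis by (subst (asm) sum_nonneg_eq_0_iff) (auto simp: vec_eq_iff)
    qed
    then show ?thesis by (auto simp: l1_ball_def)
  qed
  then show ?thesis using True zero_in_cross_polytope by auto
next
  case False
  then have r: "0 < r" using assms by simp
  have "(\<Sum>i\<in>UNIV. \<bar>(inverse r *\<^sub>R y) $ i\<bar>) \<le> 1 \<longleftrightarrow> (\<Sum>i\<in>UNIV. \<bar>y $ i\<bar>) \<le> r" for y :: "real ^ 'a"
  proof -
    have "(\<Sum>i\<in>UNIV. \<bar>(inverse r *\<^sub>R y) $ i\<bar>) = (\<Sum>i\<in>UNIV. \<bar>y $ i\<bar>) / r"
      using r by (simp add: abs_mult sum_distrib_left divide_inverse mult.commute)
    then show ?thesis using r by (simp add: pos_divide_le_eq)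
  qed
  then have inv: "inverse r *\<^sub>R y \<in> l1_ball 1 I \<longleftrightarrow> y \<in> l1_ball r I" for y
    using r by (simp add: l1_ball_def)
  have "y \<in> (*\<^sub>R) r ` l1_ball 1 I \<longleftrightarrow> inverse r *\<^sub>R y \<in> l1_ball 1 I" for y
    using r by (auto intro: image_eqI[where x = "inverse r *\<^sub>R y"])
  then show ?thesis using inv unfolding cross_polytope_eq_l1_ball by blast
qed

lemma Q_polytope_eq:
  "Q_polytope m E k = {\<Sum>j\<in>{1..m}. y j |y. \<forall>j\<in>{1..m}. y j \<in> l1_ball (real (k j)) (nbrs E j)}"
  unfolding Q_polytope_def by (subst set_sum_alt) (simp_all add: scaled_cross_polytope)

text \<open>Dilation only rescales the multiplicities, so one formula for arbitrary \<open>k\<close>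
  counts the integer points of all dilates.\<close>

lemma scaleR_Q_polytope: "(*\<^sub>R) (real t) ` Q_polytope m E k = Q_polytope m E (\<lambda>j. t * k j)"
proof -
  have sc: "(*\<^sub>R) (real t) ` l1_ball (real (k j)) (nbrs E j) = l1_ball (real (t * k j)) (nbrs E j)" for j
  proof -
    have "(*\<^sub>R) (real t) ` l1_ball (real (k j)) (nbrs E j)
        = (*\<^sub>R) (real t) ` (*\<^sub>R) (real (k j)) ` cross_polytope (nbrs E j)"
      by (simp only: scaled_cross_polytope of_nat_0_le_iff)
    also have "\<dots> = (*\<^sub>R) (real (t * k j)) ` cross_polytope (nbrs E j)"
      by (simp only: image_image scaleR_scaleR of_nat_mult)
    also have "\<dots> = l1_ball (real (t * k j)) (nbrs E j)"
      by (simp only: scaled_cross_polytope of_nat_0_le_iff)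
    finally show ?thesis .
  qed
  show ?thesis
  proof
    show "(*\<^sub>R) (real t) ` Q_polytope m E k \<subseteq> Q_polytope m E (\<lambda>j. t * k j)"
    proof (rule image_subsetI)
      fix x assume "x \<in> Q_polytope m E k"
      then obtain y where y: "x = (\<Sum>j\<in>{1..m}. y j)"
        "\<And>j. j \<in> {1..m} \<Longrightarrow> y j \<in> l1_ball (real (k j)) (nbrs E j)"
        unfolding Q_polytope_eq by blast
      have "real t *\<^sub>R y j \<in> l1_ball (real (t * k j)) (nbrs E j)" if "j \<in> {1..m}" for j
        using sc[of j] y(2)[OF that] by blast
      moreover have "real t *\<^sub>R x = (\<Sum>j\<in>{1..m}. real t *\<^sub>R y j)" by (simp add: y(1) scaleR_sum_right)
      ultimately show "real t *\<^sub>R x \<in> Q_polytope m E (\<lambda>j. t * k j)" unfolding Q_polytope_eq by blast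
    qed
    show "Q_polytope m E (\<lambda>j. t * k j) \<subseteq> (*\<^sub>R) (real t) ` Q_polytope m E k"
    proof
      fix x assume "x \<in> Q_polytope m E (\<lambda>j. t * k j)"
      then obtain y where y: "x = (\<Sum>j\<in>{1..m}. y j)"
        "\<And>j. j \<in> {1..m} \<Longrightarrow> y j \<in> l1_ball (real (t * k j)) (nbrs E j)"
        unfolding Q_polytope_eq by blast
      have "\<exists>z. z \<in> l1_ball (real (k j)) (nbrs E j) \<and> y j = real t *\<^sub>R z" if "j \<in> {1..m}" for j
        using sc[of j] y(2)[OF that] by blast
      then obtain z where z: "\<And>j. j \<in> {1..m} \<Longrightarrow> z j \<in> l1_ball (real (k j)) (nbrs E j)"
        "\<And>j. j \<in> {1..m} \<Longrightarrow> y j = real t *\<^sub>R z j" by metis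
      have "x = real t *\<^sub>R (\<Sum>j\<in>{1..m}. z j)" unfolding y(1) scaleR_sum_right using z by (intro sum.cong) auto
      moreover have "(\<Sum>j\<in>{1..m}. z j) \<in> Q_polytope m E k" unfolding Q_polytope_eq using z by blast
      ultimately show "x \<in> (*\<^sub>R) (real t) ` Q_polytope m E k" by blast
    qed
  qed
qed

section \<open>Integer points of the polytope\<close>

abbreviation Q_vectors :: "nat \<Rightarrow> (nat \<times> 'n) set \<Rightarrow> (nat \<Rightarrow> nat) \<Rightarrow> ('n \<Rightarrow> nat) set" where
  "Q_vectors m E k \<equiv> degree_vectors (copied_edges E) (copies {1..m} k) UNIV"

text \<open>In a decomposition of \<open>z\<close>, only summands with a neighbour in
  \<open>S\<close> contribute to the coordinates in \<open>S\<close>, each at most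
  \<open>k j\<close> in l1-norm. This is Hall's condition for the copies.\<close>

lemma Q_vectors_if_in_Q_polytope:
  fixes E :: "(nat \<times> 'n::finite) set"
  assumes z: "z \<in> Q_polytope m E k" and x: "\<And>i. \<bar>z $ i\<bar> = real (x i)"
  shows "x \<in> Q_vectors m E k"
proof (rule hall_degree_vectors)
  obtain y where y: "z = (\<Sum>j\<in>{1..m}. y j)"
    "\<And>j. j \<in> {1..m} \<Longrightarrow> y j \<in> l1_ball (real (k j)) (nbrs E j)"
    using z unfolding Q_polytope_eq by blast
  fix S :: "'n set"
  define H where "H = {j \<in> {1..m}. \<exists>i\<in>S. (j, i) \<in> E}"
  have part: "(\<Sum>i\<in>S. \<bar>y j $ i\<bar>) \<le> (if j \<in> H then real (k j) else 0)" if j: "j \<in> {1..m}" for j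
  proof (cases "j \<in> H")
    case True
    have "(\<Sum>i\<in>S. \<bar>y j $ i\<bar>) \<le> (\<Sum>i\<in>UNIV. \<bar>y j $ i\<bar>)" by (intro sum_mono2) auto
    also have "\<dots> \<le> real (k j)" using y(2)[OF j] by (simp add: l1_ball_def)
    finally show ?thesis using True by simp
  next
    case False
    then have "y j $ i = 0" if "i \<in> S" for i
      using y(2)[OF j] j that by (auto simp: l1_ball_def H_def nbrs_def)
    then show ?thesis using False by simp
  qed
  have "real (sum x S) = (\<Sum>i\<in>S. \<bar>z $ i\<bar>)" by (simp add: x)
  also have "\<dots> \<le> (\<Sum>i\<in>S. \<Sum>j\<in>{1..m}. \<bar>y j $ i\<bar>)"
    unfolding y(1) by (intro sum_mono) (simp add: sum_abs)
  also have "\<dots> = (\<Sum>j\<in>{1..m}. \<Sum>i\<in>S. \<bar>y j $ i\<bar>)" by (rule sum.swap)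
  also have "\<dots> \<le> (\<Sum>j\<in>{1..m}. if j \<in> H then real (k j) else 0)" by (intro sum_mono part)
  also have "\<dots> = (\<Sum>j\<in>H. real (k j))"
  proof -
    have "{1..m} \<inter> H = H" by (auto simp: H_def)
    then show ?thesis using sum.inter_restrict[of "{1..m}" "\<lambda>j. real (k j)" H] by simp
  qed
  also have "\<dots> = real (card (SIGMA j:H. {..<k j}))" by (subst card_SigmaI) (auto simp: H_def)
  also have "(SIGMA j:H. {..<k j}) = {p \<in> copies {1..m} k. \<exists>i\<in>S. (p, i) \<in> copied_edges E}"
    by (auto simp: H_def copies_def copied_edges_def)
  finally show "sum x S \<le> card {p \<in> copies {1..m} k. \<exists>i\<in>S. (p, i) \<in> copied_edges E}" by linarith
qed (simp_all add: finite_copies)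

text \<open>The summand of \<open>j\<close> has at \<open>i\<close> the number of copies of
  \<open>j\<close> assigned to \<open>i\<close>, with the sign of \<open>z $ i\<close>. Each copy is
  assigned at most once, so the l1-norm is at most \<open>k j\<close>.\<close>

lemma in_Q_polytope_if_Q_vectors:
  fixes E :: "(nat \<times> 'n::finite) set"
  assumes x: "x \<in> Q_vectors m E k" and z: "\<And>i. \<bar>z $ i\<bar> = real (x i)"
  shows "z \<in> Q_polytope m E k"
proof -
  obtain \<sigma> where \<sigma>: "\<And>p i. p \<in> copies {1..m} k \<Longrightarrow> \<sigma> p = Some i \<Longrightarrow> (fst p, i) \<in> E"
    "\<And>i. card {p \<in> copies {1..m} k. \<sigma> p = Some i} = x i"
    using x unfolding degree_vectors_def copied_edges_def by auto
  define n where "n j i = card {c \<in> {..<k j}. \<sigma> (j, c) = Some i}" for j i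
  define y :: "nat \<Rightarrow> real ^ 'n" where "y j = (\<chi> i. sgn (z $ i) * real (n j i))" for j
  have n_sum: "(\<Sum>j\<in>{1..m}. n j i) = x i" for i
  proof -
    have "{p \<in> copies {1..m} k. \<sigma> p = Some i} = (SIGMA j:{1..m}. {c \<in> {..<k j}. \<sigma> (j, c) = Some i})"
      by (auto simp: copies_def)
    then show ?thesis using \<sigma>(2)[of i] by (simp add: n_def)
  qed
  have "y j \<in> l1_ball (real (k j)) (nbrs E j)" if j: "j \<in> {1..m}" for j
  proof -
    have "y j $ i = 0" if "i \<notin> nbrs E j" for i
    proof -
      have "{c \<in> {..<k j}. \<sigma> (j, c) = Some i} = {}"
        using \<sigma>(1)[of "(j, _)" i] j that by (auto simp: nbrs_def copies_def)
      then show ?thesis by (simp only: y_def n_def) simp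
    qed
    moreover have "(\<Sum>i\<in>UNIV. \<bar>y j $ i\<bar>) \<le> real (k j)"
    proof -
      have "(\<Sum>i\<in>UNIV. \<bar>y j $ i\<bar>) \<le> (\<Sum>i\<in>UNIV. real (n j i))"
        by (intro sum_mono) (auto simp: y_def abs_mult sgn_if)
      also have "\<dots> = real (card (\<Union>i\<in>UNIV. {c \<in> {..<k j}. \<sigma> (j, c) = Some i}))"
        unfolding n_def of_nat_sum[symmetric] by (subst card_UN_disjoint) auto
      also have "card (\<Union>i\<in>UNIV. {c \<in> {..<k j}. \<sigma> (j, c) = Some i}) \<le> card {..<k j}"
        by (intro card_mono) auto
      finally show ?thesis by simp
    qed
    ultimately show ?thesis by (simp add: l1_ball_def)
  qed
  moreover have "z = (\<Sum>j\<in>{1..m}. y j)"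
  proof (rule vec_eq_iff[THEN iffD2], rule allI)
    fix i
    have "(\<Sum>j\<in>{1..m}. y j) $ i = sgn (z $ i) * real (\<Sum>j\<in>{1..m}. n j i)"
      by (simp add: y_def sum_distrib_left)
    also have "\<dots> = z $ i" unfolding n_sum using z[of i] by (metis mult_sgn_abs mult.commute)
    finally show "z $ i = (\<Sum>j\<in>{1..m}. y j) $ i" by simp
  qed
  ultimately show ?thesis unfolding Q_polytope_eq by blast
qed

lemma card_abs_fibre:
  fixes x :: "'n::finite \<Rightarrow> nat"
  shows "finite {z :: real ^ 'n. \<forall>i. \<bar>z $ i\<bar> = real (x i)}"
    and "card {z :: real ^ 'n. \<forall>i. \<bar>z $ i\<bar> = real (x i)} = 2 ^ card {i. 0 < x i}"
proof -
  let ?F = "\<Pi>\<^sub>E i\<in>UNIV. {real (x i), - real (x i)}"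
  have eq: "{z :: real ^ 'n. \<forall>i. \<bar>z $ i\<bar> = real (x i)} = vec_lambda ` ?F"
  proof safe
    fix z :: "real ^ 'n" assume z: "\<forall>i. \<bar>z $ i\<bar> = real (x i)"
    have "z $ i \<in> {real (x i), - real (x i)}" for i
      using z[rule_format, of i] by (auto simp: abs_if split: if_splits)
    then have "vec_nth z \<in> ?F" by auto
    then show "z \<in> vec_lambda ` ?F" by (rule image_eqI[rotated]) (simp add: vec_nth_inverse)
  next
    fix f i assume f: "f \<in> ?F"
    then have "f i \<in> {real (x i), - real (x i)}" by blast
    then show "\<bar>vec_lambda f $ i\<bar> = real (x i)" by auto
  qed
  have fin: "finite ?F" by (intro finite_PiE) auto
  then show "finite {z :: real ^ 'n. \<forall>i. \<bar>z $ i\<bar> = real (x i)}" unfolding eq by simp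
  have "card {z :: real ^ 'n. \<forall>i. \<bar>z $ i\<bar> = real (x i)} = card ?F"
    unfolding eq by (intro card_image inj_onI) (simp add: vec_lambda_inject)
  also have "\<dots> = (\<Prod>i\<in>UNIV. if 0 < x i then 2 else 1)"
    by (subst card_PiE) (auto intro!: prod.cong)
  also have "\<dots> = 2 ^ card {i. 0 < x i}"
    by (simp add: prod.If_cases)
  finally show "card {z :: real ^ 'n. \<forall>i. \<bar>z $ i\<bar> = real (x i)} = 2 ^ card {i. 0 < x i}" .
qed

text \<open>Integer points are grouped by their absolute values, which are exactly the
  \<open>Q_vectors\<close>; each fibre consists of the sign choices on the support.\<close>

lemma card_Q_polytope_integer_points:
  fixes E :: "(nat \<times> 'n::finite) set"
  shows "card (Q_polytope m E k \<inter> integer_points)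
    = (\<Sum>a\<in>degree_vectors (E\<inverse>) UNIV {1..m}. \<Prod>j\<in>{1..m}. cross_weight (k j) (a j))"
proof -
  let ?Z = "\<lambda>x::'n \<Rightarrow> nat. {z :: real ^ 'n. \<forall>i. \<bar>z $ i\<bar> = real (x i)}"
  have "Q_polytope m E k \<inter> integer_points = (\<Union>x\<in>Q_vectors m E k. ?Z x)"
  proof
    show "Q_polytope m E k \<inter> integer_points \<subseteq> (\<Union>x\<in>Q_vectors m E k. ?Z x)"
    proof
      fix z assume z: "z \<in> Q_polytope m E k \<inter> integer_points"
      define x where "x i = nat \<lfloor>\<bar>z $ i\<bar>\<rfloor>" for i
      have x: "\<bar>z $ i\<bar> = real (x i)" for i
      proof -
        have "\<bar>z $ i\<bar> \<in> \<int>" using z by (simp add: integer_points_def)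
        then obtain n where n: "\<bar>z $ i\<bar> = of_int n" by (rule Ints_cases)
        then have "0 \<le> n" using abs_ge_zero[of "z $ i"] by simp
        then show ?thesis by (simp add: x_def n)
      qed
      then have "x \<in> Q_vectors m E k" using z by (intro Q_vectors_if_in_Q_polytope[of z]) auto
      then show "z \<in> (\<Union>x\<in>Q_vectors m E k. ?Z x)" using x by blast
    qed
    show "(\<Union>x\<in>Q_vectors m E k. ?Z x) \<subseteq> Q_polytope m E k \<inter> integer_points"
    proof
      fix z assume "z \<in> (\<Union>x\<in>Q_vectors m E k. ?Z x)"
      then obtain x where x: "x \<in> Q_vectors m E k" "\<And>i. \<bar>z $ i\<bar> = real (x i)" by blast
      have "z $ i \<in> \<int>" for i
      proof -
        have "z $ i = real (x i) \<or> z $ i = - real (x i)" using x(2)[of i] by linarith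
        then show ?thesis by auto
      qed
      then show "z \<in> Q_polytope m E k \<inter> integer_points"
        using in_Q_polytope_if_Q_vectors[OF x] by (simp add: integer_points_def)
    qed
  qed
  also have "card (\<Union>x\<in>Q_vectors m E k. ?Z x) = (\<Sum>x\<in>Q_vectors m E k. card (?Z x))"
  proof (rule card_UN_disjoint)
    show "finite (Q_vectors m E k)" by (intro finite_degree_vectors finite_copies) auto
    show "\<forall>x\<in>Q_vectors m E k. finite (?Z x)" using card_abs_fibre(1) by blast
    show "\<forall>x\<in>Q_vectors m E k. \<forall>x'\<in>Q_vectors m E k. x \<noteq> x' \<longrightarrow> ?Z x \<inter> ?Z x' = {}"
    proof (intro ballI impI)
      fix x x' :: "'n \<Rightarrow> nat" assume "x \<noteq> x'"
      then obtain i where "x i \<noteq> x' i" by blast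
      moreover have "x i = x' i" if "z \<in> ?Z x \<inter> ?Z x'" for z
      proof -
        have "\<forall>i. \<bar>z $ i\<bar> = real (x i)" "\<forall>i. \<bar>z $ i\<bar> = real (x' i)" using that by blast+
        then show ?thesis by (metis of_nat_eq_iff)
      qed
      ultimately show "?Z x \<inter> ?Z x' = {}" by blast
    qed
  qed
  also have "\<dots> = (\<Sum>x\<in>Q_vectors m E k. 2 ^ card {i \<in> UNIV. 0 < x i})"
    by (simp add: card_abs_fibre(2))
  also have "\<dots> = (\<Sum>a\<in>degree_vectors (E\<inverse>) UNIV {1..m}. \<Prod>j\<in>{1..m}. cross_weight (k j) (a j))"
    by (rule sum_degree_vectors_copies) auto
  finally show ?thesis .
qed

section \<open>Dimension of the polytope\<close>

definition active_nbrs :: "nat \<Rightarrow> (nat \<times> 'n) set \<Rightarrow> (nat \<Rightarrow> nat) \<Rightarrow> 'n set" where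
  "active_nbrs m E k = {i. \<exists>j\<in>{1..m}. 0 < k j \<and> (j, i) \<in> E}"

lemma zero_in_Q_polytope: "0 \<in> Q_polytope m E k"
proof -
  have "(\<Sum>j\<in>{1..m}. 0) = (0 :: real ^ 'a)" by simp
  moreover have "(0 :: real ^ 'a) \<in> l1_ball (real (k j)) (nbrs E j)" for j by (simp add: l1_ball_def)
  ultimately show ?thesis unfolding Q_polytope_eq
    by (intro CollectI exI[of _ "\<lambda>_. 0"]) simp
qed

text \<open>The polytope contains the origin and the unit vectors of the active coordinates, and it
  lies in the coordinate subspace that they span.\<close>

lemma aff_dim_Q_polytope:
  fixes E :: "(nat \<times> 'n::finite) set"
  shows "aff_dim (Q_polytope m E k) = int (card (active_nbrs m E k))"
proof -
  let ?N = "active_nbrs m E k"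
  let ?V = "{x :: real ^ 'n. \<forall>i. i \<notin> ?N \<longrightarrow> x $ i = 0}"
  have dimV: "dim ?V = card ?N" by (simp only: dim_vec_eq[symmetric] dim_substandard_cart)
  have sub: "Q_polytope m E k \<subseteq> ?V"
  proof
    fix x assume "x \<in> Q_polytope m E k"
    then obtain y where y: "x = (\<Sum>j\<in>{1..m}. y j)"
      "\<And>j. j \<in> {1..m} \<Longrightarrow> y j \<in> l1_ball (real (k j)) (nbrs E j)"
      unfolding Q_polytope_eq by blast
    have "y j $ i = 0" if i: "i \<notin> ?N" and j: "j \<in> {1..m}" for i j
    proof (cases "k j = 0")
      case True
      have "\<bar>y j $ i\<bar> \<le> (\<Sum>i\<in>UNIV. \<bar>y j $ i\<bar>)" by (rule member_le_sum) auto
      also have "\<dots> \<le> 0" using y(2)[OF j] True by (simp add: l1_ball_def)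
      finally show ?thesis by simp
    next
      case False
      then have "0 < k j" by simp
      then have "i \<notin> nbrs E j" using i j unfolding active_nbrs_def nbrs_def by blast
      then show ?thesis using y(2)[OF j] by (simp add: l1_ball_def)
    qed
    then show "x \<in> ?V" by (simp add: y(1))
  qed
  have ax: "axis i 1 \<in> Q_polytope m E k" if "i \<in> ?N" for i
  proof -
    obtain j where j: "j \<in> {1..m}" "0 < k j" "(j, i) \<in> E" using \<open>i \<in> ?N\<close> by (auto simp: active_nbrs_def)
    have "axis i 1 = (\<Sum>l\<in>{1..m}. if l = j then axis i (1::real) else 0)" using j by simp
    moreover have "\<forall>l\<in>{1..m}. (if l = j then axis i 1 else 0) \<in> l1_ball (real (k l)) (nbrs E l)"
      using j by (auto simp: l1_ball_def l1_norm_axis nbrs_def) (auto simp: axis_def)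
    ultimately show ?thesis unfolding Q_polytope_eq
      by (intro CollectI exI[of _ "\<lambda>l. if l = j then axis i 1 else 0"]) simp
  qed
  have "?V \<subseteq> span (Q_polytope m E k)"
  proof
    fix x assume x: "x \<in> ?V"
    have "x = (\<Sum>i\<in>?N. (x $ i) *\<^sub>R axis i 1)"
    proof (rule vec_eq_iff[THEN iffD2], rule allI)
      fix l
      have "(\<Sum>i\<in>?N. (x $ i) *\<^sub>R axis i 1) $ l = (\<Sum>i\<in>?N. if i = l then x $ l else 0)"
        unfolding sum_component by (intro sum.cong) (auto simp: axis_def)
      then show "x $ l = (\<Sum>i\<in>?N. (x $ i) *\<^sub>R axis i 1) $ l" using x by simp
    qed
    also have "\<dots> \<in> span (Q_polytope m E k)"
      using ax by (intro span_sum span_scale span_base)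
    finally show "x \<in> span (Q_polytope m E k)" .
  qed
  then have "card ?N \<le> dim (Q_polytope m E k)" using dim_mono[of ?V] dimV by simp
  moreover have "dim (Q_polytope m E k) \<le> card ?N" using dim_subset[OF sub] dimV by simp
  ultimately have "dim (Q_polytope m E k) = card ?N" by simp
  then show ?thesis
    using aff_dim_zero[OF hull_inc[OF zero_in_Q_polytope[of m E k]]] by simp
qed

section \<open>Coefficients of the Ehrhart polynomial\<close>

lemma coeff_prod_nonneg:
  fixes f :: "'a \<Rightarrow> 'b::linordered_idom poly"
  assumes "\<And>j i. j \<in> M \<Longrightarrow> 0 \<le> coeff (f j) i"
  shows "0 \<le> coeff (\<Prod>j\<in>M. f j) i"
  using assms
proof (induction M arbitrary: i rule: infinite_finite_induct)
  case (insert j M)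
  then show ?case by (auto simp: coeff_mult intro!: sum_nonneg)
qed (auto simp: coeff_1)

text \<open>In the Cauchy product one term is positive by induction and the others are nonnegative,
  so nothing cancels.\<close>

lemma coeff_prod_pos:
  fixes f :: "'a \<Rightarrow> 'b::linordered_idom poly"
  assumes "finite M" "\<And>j i. j \<in> M \<Longrightarrow> 0 \<le> coeff (f j) i" "\<And>j. j \<in> M \<Longrightarrow> 0 < coeff (f j) (n j)"
  shows "0 < coeff (\<Prod>j\<in>M. f j) (\<Sum>j\<in>M. n j)"
  using assms
proof (induction M rule: finite_induct)
  case (insert j M)
  have "0 < coeff (f j) (n j) * coeff (\<Prod>j\<in>M. f j) (\<Sum>j\<in>M. n j)"
    using insert by auto
  also have "\<dots> = coeff (f j) (n j) * coeff (\<Prod>j\<in>M. f j) ((n j + (\<Sum>j\<in>M. n j)) - n j)" by simp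
  also have "\<dots> \<le> (\<Sum>i\<le>n j + (\<Sum>j\<in>M. n j). coeff (f j) i * coeff (\<Prod>j\<in>M. f j) ((n j + (\<Sum>j\<in>M. n j)) - i))"
    using insert.prems(1) coeff_prod_nonneg[of M f]
    by (intro member_le_sum[where f = "\<lambda>i. coeff (f j) i * coeff (\<Prod>j\<in>M. f j) ((n j + (\<Sum>j\<in>M. n j)) - i)"]) auto
  finally show ?case using insert.hyps by (simp add: coeff_mult)
qed simp

text \<open>The contribution of the left degree vector \<open>a\<close>; the inner polynomial
  substitutes \<open>k j\<close> times the dilation factor.\<close>

definition Q_term :: "nat \<Rightarrow> (nat \<Rightarrow> nat) \<Rightarrow> (nat \<Rightarrow> nat) \<Rightarrow> real poly" where
  "Q_term m k a = (\<Prod>j\<in>{1..m}. pcompose (cross_poly (a j)) [:0, real (k j):])"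

lemma coeff_Q_factor_nonneg: "0 \<le> coeff (pcompose (cross_poly b) [:0, real n:]) i"
  by (simp add: coeff_pcompose_linear cross_poly_coeff_nonneg)

lemma coeff_Q_term_nonneg: "0 \<le> coeff (Q_term m k a) i"
  unfolding Q_term_def by (intro coeff_prod_nonneg coeff_Q_factor_nonneg)

lemma poly_Q_term: "poly (Q_term m k a) (real t) = real (\<Prod>j\<in>{1..m}. cross_weight (t * k j) (a j))"
proof -
  have "poly (cross_poly b) (real t * real n) = real (cross_weight (t * n) b)" for b n
    using poly_cross_poly[of b "t * n"] by simp
  then show ?thesis by (simp add: Q_term_def poly_prod poly_pcompose)
qed

text \<open>The degree is at most the sum of the \<open>a j\<close>, which counts right vertices
  assigned to left vertices. If \<open>a j\<close> is positive only where \<open>k j\<close> is,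
  these right vertices are all active; otherwise the term is 0.\<close>

lemma degree_Q_term:
  fixes E :: "(nat \<times> 'n::finite) set"
  assumes a: "a \<in> degree_vectors (E\<inverse>) UNIV {1..m}"
  shows "degree (Q_term m k a) \<le> card (active_nbrs m E k)"
proof (cases "\<exists>j\<in>{1..m}. k j = 0 \<and> a j \<noteq> 0")
  case True
  then obtain j where j: "j \<in> {1..m}" "k j = 0" "a j \<noteq> 0" by blast
  \<comment> \<open>For \<open>k j = 0\<close> the factor is the constant
    \<open>poly (cross_poly (a j)) 0\<close>, which vanishes for
    \<open>a j \<noteq> 0\<close>.\<close>
  have "pcompose (cross_poly (a j)) [:0, real (k j):] = 0"
    using j cross_poly_at_0[of "a j"] by (simp add: pcompose_0' poly_0_coeff_0)
  then have "Q_term m k a = 0" using j(1) unfolding Q_term_def by (intro prod_zero) auto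
  then show ?thesis by simp
next
  case False
  obtain \<sigma> where "\<forall>i\<in>UNIV. \<forall>j. \<sigma> i = Some j \<longrightarrow> j \<in> {1..m} \<and> (i, j) \<in> E\<inverse>"
    "\<forall>j\<in>{1..m}. card {i \<in> UNIV. \<sigma> i = Some j} = a j"
    using a unfolding degree_vectors_def by blast
  then have \<sigma>: "\<And>i j. \<sigma> i = Some j \<Longrightarrow> (j, i) \<in> E"
    "\<And>j. j \<in> {1..m} \<Longrightarrow> card {i. \<sigma> i = Some j} = a j"
    by simp_all
  have "degree (Q_term m k a) \<le> (\<Sum>j\<in>{1..m}. degree (pcompose (cross_poly (a j)) [:0, real (k j):]))"
    unfolding Q_term_def using degree_prod_sum_le[of "{1..m}"] by (simp add: comp_def)
  also have "\<dots> \<le> (\<Sum>j\<in>{1..m}. a j)"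
  proof (intro sum_mono)
    fix j
    have "degree (pcompose (cross_poly (a j)) [:0, real (k j):]) \<le> degree (cross_poly (a j)) * degree [:0, real (k j):]"
      by (rule degree_pcompose_le)
    also have "\<dots> \<le> a j * 1" by (intro mult_le_mono cross_poly_degree) simp
    finally show "degree (pcompose (cross_poly (a j)) [:0, real (k j):]) \<le> a j" by simp
  qed
  also have "\<dots> = (\<Sum>j\<in>{1..m}. card {i. \<sigma> i = Some j})" using \<sigma>(2) by simp
  also have "\<dots> = card (\<Union>j\<in>{1..m}. {i. \<sigma> i = Some j})" by (rule card_UN_disjoint[symmetric]) auto
  also have "\<dots> \<le> card (active_nbrs m E k)"
  proof (rule card_mono)
    show "(\<Union>j\<in>{1..m}. {i. \<sigma> i = Some j}) \<subseteq> active_nbrs m E k"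
    proof
      fix i assume "i \<in> (\<Union>j\<in>{1..m}. {i. \<sigma> i = Some j})"
      then obtain j where j: "j \<in> {1..m}" "\<sigma> i = Some j" by blast
      have "card {i. \<sigma> i = Some j} \<noteq> 0" using j by auto
      then have "0 < k j" using \<sigma>(2)[OF j(1)] False j by auto
      then show "i \<in> active_nbrs m E k" using \<sigma>(1)[OF j(2)] j unfolding active_nbrs_def by blast
    qed
  qed simp
  finally show ?thesis .
qed

text \<open>Choose \<open>i\<close> active right vertices and send each to a neighbour of positive
  multiplicity. The resulting left degrees sum to \<open>i\<close>, and the factor of
  \<open>j\<close> has a positive coefficient at \<open>a j\<close>.\<close>

lemma exists_positive_Q_term:
  fixes E :: "(nat \<times> 'n::finite) set"
  assumes "i \<le> card (active_nbrs m E k)"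
  obtains a where "a \<in> degree_vectors (E\<inverse>) UNIV {1..m}" "0 < coeff (Q_term m k a) i"
proof -
  obtain S where S: "S \<subseteq> active_nbrs m E k" "card S = i"
    using obtain_subset_with_card_n[OF assms] by metis
  then have "\<forall>r\<in>S. \<exists>j. j \<in> {1..m} \<and> 0 < k j \<and> (j, r) \<in> E" unfolding active_nbrs_def by blast
  then obtain f where f: "\<And>r. r \<in> S \<Longrightarrow> f r \<in> {1..m} \<and> 0 < k (f r) \<and> (f r, r) \<in> E" by metis
  define \<sigma> where "\<sigma> r = (if r \<in> S then Some (f r) else None)" for r
  define a where "a = (\<lambda>j\<in>{1..m}. card {r \<in> UNIV. \<sigma> r = Some j})"
  have \<sigma>: "r \<in> S \<and> f r = j" if "\<sigma> r = Some j" for r j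
    using that by (auto simp: \<sigma>_def split: if_splits)
  have mem: "a \<in> degree_vectors (E\<inverse>) UNIV {1..m}"
    unfolding degree_vectors_def
  proof (intro CollectI conjI exI[of _ \<sigma>])
    show "\<forall>r\<in>UNIV. \<forall>j. \<sigma> r = Some j \<longrightarrow> j \<in> {1..m} \<and> (r, j) \<in> E\<inverse>"
      using \<sigma> f by blast
  qed (simp_all add: a_def)
  have sum_a: "(\<Sum>j\<in>{1..m}. a j) = i"
  proof -
    have "(\<Sum>j\<in>{1..m}. a j) = (\<Sum>j\<in>{1..m}. card {r. \<sigma> r = Some j})" by (simp add: a_def)
    also have "\<dots> = card (\<Union>j\<in>{1..m}. {r. \<sigma> r = Some j})" by (rule card_UN_disjoint[symmetric]) auto
    also have "(\<Union>j\<in>{1..m}. {r. \<sigma> r = Some j}) = S"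
    proof
      show "S \<subseteq> (\<Union>j\<in>{1..m}. {r. \<sigma> r = Some j})"
      proof
        fix r assume r: "r \<in> S"
        then have "\<sigma> r = Some (f r)" by (simp add: \<sigma>_def)
        then show "r \<in> (\<Union>j\<in>{1..m}. {r. \<sigma> r = Some j})" using f[OF r] by blast
      qed
    qed (use \<sigma> in blast)
    finally show ?thesis using S by simp
  qed
  have "0 < coeff (Q_term m k a) (\<Sum>j\<in>{1..m}. a j)"
    unfolding Q_term_def
  proof (intro coeff_prod_pos coeff_Q_factor_nonneg)
    fix j assume j: "j \<in> {1..m}"
    have "0 < k j" if "a j \<noteq> 0"
    proof -
      have "card {r. \<sigma> r = Some j} = a j" using j by (simp add: a_def)
      then have "{r. \<sigma> r = Some j} \<noteq> {}" using that by (metis card.empty)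
      then show ?thesis using \<sigma> f by blast
    qed
    then have "0 < real (k j) ^ a j" by (cases "a j = 0") auto
    then show "0 < coeff (pcompose (cross_poly (a j)) [:0, real (k j):]) (a j)"
      by (simp add: coeff_pcompose_linear cross_poly_coeff_self)
  qed simp
  then show thesis using that[OF mem] by (simp only: sum_a)
qed

theorem theorem1p5:
  fixes m :: nat and E :: "(nat \<times> 'n::finite) set" and k :: "nat \<Rightarrow> nat"
  assumes "bipartite_graph {1..m} (UNIV :: 'n set) E"
  shows "ehrhart_positive (Q_polytope m E k)"
proof -
  let ?D = "degree_vectors (E\<inverse>) UNIV {1..m}" and ?d = "card (active_nbrs m E k)"
  define p where "p = (\<Sum>a\<in>?D. Q_term m k a)"
  have fin: "finite ?D" by (intro finite_degree_vectors) auto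
  have pos: "0 < coeff p i" if i: "i \<le> ?d" for i
  proof -
    obtain a where "a \<in> ?D" "0 < coeff (Q_term m k a) i" using exists_positive_Q_term[OF i] .
    then show ?thesis
      unfolding p_def coeff_sum using fin coeff_Q_term_nonneg by (intro sum_pos2) auto
  qed
  have "degree p \<le> ?d" unfolding p_def using fin degree_Q_term by (intro degree_sum_le) auto
  \<comment> \<open>Positivity of the coefficient at the dimension also fixes the degree.\<close>
  moreover have "?d \<le> degree p" using pos[of ?d] by (intro le_degree) auto
  ultimately have "int (degree p) = aff_dim (Q_polytope m E k)" by (simp add: aff_dim_Q_polytope)
  moreover have "poly p (real t) = real (lattice_count (Q_polytope m E k) t)" for t
    by (simp add: p_def poly_sum poly_Q_term lattice_count_def scaleR_Q_polytope
        card_Q_polytope_integer_points)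
  ultimately have "is_ehrhart_polynomial (Q_polytope m E k) p" by (simp add: is_ehrhart_polynomial_def)
  then show ?thesis
    unfolding ehrhart_positive_def aff_dim_Q_polytope using pos by auto
qed

end
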